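(* Let $\Lambda=[-1,1]$ and let $\mathbb{P}_\lambda$ be the uniform distribution on $[-1,1]$. Let $h:\mathbb{R}^d\times[-1,1]\to\mathbb{R}$ and assume there are constants $0<\mu\le L$ such that for all $\lambda\in[-1,1]$ the function $h(\cdot,\lambda)$ is $\mu$-strongly convex and $L$-smooth. Let $\theta^*(\lambda)$ be the minimizer of $h(\cdot,\lambda)$. Assume there exist an integer $\nu\ge 2$ and a constant $V>0$ such that for every $i=1,\dots,d$ the component $\theta^*_i(\cdot)$ has $\nu$ derivatives, the functions $\theta^*_i,\dots,\theta_i^{*(\nu-1)}$ are absolutely continuous, and $\theta_i^{*(\nu)}$ has total variation bounded by $V$. Then, if we use $q=O\big(\epsilon^{\frac{1}{2(1-\nu)}}\big)$ polynomials in the Legendre basis (so $p=qd$ basis functions) and run constant step-size stochastic gradient descent for $T=O\big(\epsilon^{\frac{1}{1-\nu}}\log(1/\epsilon)\big)$ iterations, the resulting iterate $\beta_T$ satisfies $\mathbb{E}[\epsilon_{\rm sp}(\beta_T)]\le\epsilon$. Both big-O terms are to be interpreted as $\epsilon\to0$, and both suppress constants not depending on $\epsilon$ (but possibly depending on $h$).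
   Context: $\|\cdot\|$ is the Euclidean norm. "$h(\cdot,\lambda)$ is $\mu$-strongly convex and $L$-smooth" means: for all $\theta,\bar\theta\in\mathbb{R}^d$, $\frac{\mu}{2}\|\theta-\bar\theta\|^2\le h(\theta,\lambda)-h(\bar\theta,\lambda)-\nabla_\theta h(\bar\theta,\lambda)^\top(\theta-\bar\theta)\le\frac{L}{2}\|\theta-\bar\theta\|^2$. Legendre basis: for an integer $q\ge1$, let $\psi(\lambda)\in\mathbb{R}^{1\times q}$ be the row vector of the first $q$ Legendre polynomials $P_0(\lambda),\dots,P_{q-1}(\lambda)$ (normalized so that $P_n(1)=1$). Set $p=qd$ and let $\Phi(\lambda)\in\mathbb{R}^{d\times qd}$ be the block-diagonal matrix with $d$ diagonal blocks each equal to $\psi(\lambda)$; thus each component of $\theta^*$ is approximated separately by a linear combination of the first $q$ Legendre polynomials. Let $C_p:=\sup_{\lambda\in[-1,1]}\sigma_{\max}(\Phi(\lambda)^\top\Phi(\lambda))$ (largest eigenvalue). Solution path error of $\beta\in\mathbb{R}^p$: $\epsilon_{\rm sp}(\beta):=\sup_{\lambda\in[-1,1]}\{h(\Phi(\lambda)\beta,\lambda)-h(\theta^*(\lambda),\lambda)\}$. Constant step-size stochastic gradient descent is applied to $\min_{\beta\in\mathbb{R}^p}\mathbb{E}_{\tilde\lambda\sim\mathbb{P}_\lambda}[h(\Phi(\tilde\lambda)\beta,\tilde\lambda)]$: starting from an initial point $\beta_0\in\mathbb{R}^p$, $\beta_{t+1}=\beta_t-\eta\,\Phi(\tilde\lambda_t)^\top\nabla_\theta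 h(\Phi(\tilde\lambda_t)\beta_t,\tilde\lambda_t)$, with $\tilde\lambda_0,\tilde\lambda_1,\dots$ i.i.d. from $\mathbb{P}_\lambda$ and step-size $\eta=\bar\eta/(C_pL)$ for a fixed $\bar\eta\in(0,1]$; the expectation $\mathbb{E}[\epsilon_{\rm sp}(\beta_T)]$ is over these samples. The statement specifies no particular initial point.
   Formalization: The initial points (one for each q) are assumed to have Euclidean norm growing at most polynomially in q, since for arbitrarily fast growing initial points the bound on T fails; h(θ,·) is assumed measurable on [-1,1] so that the expectations are defined. *)

theory Defs
  imports "HOL-Probability.Probability" "HOL-Library.Landau_Symbols"
begin

subsection \<open>Strong convexity and smoothness\<close>

text \<open>Only meaningful where \<open>f\<close> is differentiable; then this is the vector \<open>D\<close> with
  \<open>GDERIV f x :> D\<close>.\<close>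

definition gradient :: "('a::real_inner \<Rightarrow> real) \<Rightarrow> 'a \<Rightarrow> 'a" where
  "gradient f x = (THE D. GDERIV f x :> D)"

definition strongly_convex_smooth :: "real \<Rightarrow> real \<Rightarrow> ('a::euclidean_space \<Rightarrow> real) \<Rightarrow> bool" where
  "strongly_convex_smooth \<mu> L f \<longleftrightarrow>
     (\<forall>x. f differentiable (at x)) \<and>
     (\<forall>x y. \<mu> / 2 * (norm (x - y))\<^sup>2 \<le> f x - f y - gradient f y \<bullet> (x - y) \<and>
            f x - f y - gradient f y \<bullet> (x - y) \<le> L / 2 * (norm (x - y))\<^sup>2)"

subsection \<open>Regularity of the solution path\<close>

text \<open>In a division of an interval the pieces are compact intervals \<open>K = {Inf K..Sup K}\<close> with
  disjoint interiors.\<close>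

definition abs_continuous_on :: "real set \<Rightarrow> (real \<Rightarrow> real) \<Rightarrow> bool" where
  "abs_continuous_on S f \<longleftrightarrow>
     (\<forall>e>0. \<exists>\<delta>>0. \<forall>\<D> U. \<D> division_of U \<and> U \<subseteq> S \<and> (\<Sum>K\<in>\<D>. Sup K - Inf K) < \<delta> \<longrightarrow>
        (\<Sum>K\<in>\<D>. \<bar>f (Sup K) - f (Inf K)\<bar>) < e)"

definition total_variation :: "real set \<Rightarrow> (real \<Rightarrow> real) \<Rightarrow> ereal" where
  "total_variation S f =
     (SUP \<D> \<in> {\<D>. \<D> division_of S}. ereal (\<Sum>K\<in>\<D>. \<bar>f (Sup K) - f (Inf K)\<bar>))"

text \<open>\<open>D j\<close> is the \<open>j\<close>-th derivative of \<open>f\<close> on \<open>{-1..1}\<close>, one-sided at the end points.\<close>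

definition derivatives_bv :: "nat \<Rightarrow> real \<Rightarrow> (real \<Rightarrow> real) \<Rightarrow> bool" where
  "derivatives_bv \<nu> V f \<longleftrightarrow>
     (\<exists>D :: nat \<Rightarrow> real \<Rightarrow> real.
        (\<forall>x\<in>{-1..1}. D 0 x = f x) \<and>
        (\<forall>j<\<nu>. \<forall>x\<in>{-1..1}. (D j has_real_derivative D (Suc j) x) (at x within {-1..1})) \<and>
        (\<forall>j<\<nu>. abs_continuous_on {-1..1} (D j)) \<and>
        total_variation {-1..1} (D \<nu>) \<le> ereal V)"

subsection \<open>The Legendre basis\<close>

text \<open>Bonnet's recursion \<open>(n + 2) P\<^sub>n\<^sub>+\<^sub>2 = (2 n + 3) x P\<^sub>n\<^sub>+\<^sub>1 - (n + 1) P\<^sub>n\<close>.\<close>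

fun legendre :: "nat \<Rightarrow> real \<Rightarrow> real" where
  "legendre 0 x = 1"
| "legendre (Suc 0) x = x"
| "legendre (Suc (Suc n)) x =
     (real (2 * n + 3) * x * legendre (Suc n) x - real (n + 1) * legendre n x) / real (n + 2)"

lemma legendre_at_1: "legendre n 1 = 1"
  by (induction n "1::real" rule: legendre.induct) (simp_all add: field_simps)

text \<open>Since the dimension \<open>p = q d\<close> varies with \<open>q\<close>, a vector in \<open>p\<close>-dimensional space is a
  function \<open>\<beta> :: 'd \<times> nat \<Rightarrow> real\<close> of which only the values on the \<open>p\<close>-element set
  \<open>coeff_index q\<close> count; \<open>\<beta> (i, n)\<close> is the coefficient of the \<open>n\<close>-th Legendre polynomial in the
  \<open>i\<close>-th block.  Its Euclidean norm is \<open>L2_set \<beta> (coeff_index q)\<close>.  The matrix \<open>\<Phi>(\<lambda>)\<close> has rows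
  indexed by \<open>'d\<close> and columns indexed by \<open>coeff_index q\<close>.\<close>

definition coeff_index :: "nat \<Rightarrow> ('d::finite \<times> nat) set" where
  "coeff_index q = UNIV \<times> {..<q}"

definition Phi :: "real \<Rightarrow> 'd::finite \<Rightarrow> 'd \<times> nat \<Rightarrow> real" where
  "Phi l i = (\<lambda>(j, n). if j = i then legendre n l else 0)"

definition Phi_mult :: "nat \<Rightarrow> real \<Rightarrow> ('d::finite \<times> nat \<Rightarrow> real) \<Rightarrow> real ^ 'd" where
  "Phi_mult q l \<beta> = (\<chi> i. \<Sum>c\<in>coeff_index q. Phi l i c * \<beta> c)"

definition Phi_transpose_mult :: "real \<Rightarrow> real ^ 'd \<Rightarrow> 'd::finite \<times> nat \<Rightarrow> real" where
  "Phi_transpose_mult l g = (\<lambda>c. \<Sum>i\<in>UNIV. Phi l i c * g $ i)"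

definition Phi_gram :: "real \<Rightarrow> 'd::finite \<times> nat \<Rightarrow> 'd \<times> nat \<Rightarrow> real" where
  "Phi_gram l c c' = (\<Sum>i\<in>UNIV. Phi l i c * Phi l i c')"

text \<open>Eigenvalues of a square matrix with rows and columns indexed by the finite set \<open>I\<close>.\<close>

definition eigenvalue_on :: "'c set \<Rightarrow> ('c \<Rightarrow> 'c \<Rightarrow> real) \<Rightarrow> real \<Rightarrow> bool" where
  "eigenvalue_on I A r \<longleftrightarrow>
     (\<exists>v. (\<exists>c\<in>I. v c \<noteq> 0) \<and> (\<forall>c\<in>I. (\<Sum>c'\<in>I. A c c' * v c') = r * v c))"

definition sigma_max :: "'c set \<Rightarrow> ('c \<Rightarrow> 'c \<Rightarrow> real) \<Rightarrow> real" where
  "sigma_max I A = Max {r. eigenvalue_on I A r}"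

definition C_p :: "'d::finite itself \<Rightarrow> nat \<Rightarrow> real" where
  "C_p d q = (SUP l\<in>{-1..1}. sigma_max (coeff_index q :: ('d \<times> nat) set) (Phi_gram l))"

subsection \<open>Solution path error and stochastic gradient descent\<close>

definition solution_path_error ::
  "(real ^ 'd \<Rightarrow> real \<Rightarrow> real) \<Rightarrow> (real \<Rightarrow> real ^ 'd) \<Rightarrow> nat \<Rightarrow> ('d::finite \<times> nat \<Rightarrow> real) \<Rightarrow> real" where
  "solution_path_error h \<theta>s q \<beta> = (SUP l\<in>{-1..1}. h (Phi_mult q l \<beta>) l - h (\<theta>s l) l)"

text \<open>The iterates started at \<open>\<beta>\<^sub>0\<close> with step size \<open>\<eta>\<close> for the sample sequence \<open>s\<close>.\<close>

primrec sgd ::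
  "(real ^ 'd \<Rightarrow> real \<Rightarrow> real) \<Rightarrow> nat \<Rightarrow> real \<Rightarrow> ('d::finite \<times> nat \<Rightarrow> real) \<Rightarrow> (nat \<Rightarrow> real)
     \<Rightarrow> nat \<Rightarrow> 'd \<times> nat \<Rightarrow> real" where
  "sgd h q \<eta> \<beta>\<^sub>0 s 0 = \<beta>\<^sub>0"
| "sgd h q \<eta> \<beta>\<^sub>0 s (Suc t) =
     (let \<beta> = sgd h q \<eta> \<beta>\<^sub>0 s t
      in (\<lambda>c. \<beta> c - \<eta> * Phi_transpose_mult (s t)
                          (gradient (\<lambda>\<theta>. h \<theta> (s t)) (Phi_mult q (s t) \<beta>)) c))"

end

theory Submission
  imports Defs
begin

text \<open>
  Integrating by parts \<open>\<nu>\<close> times and using bounded variation once gives Legendre coefficients of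
  size \<open>O(n\<^sup>-\<^sup>\<nu>)\<close>.  Hence the truncated expansion \<open>b\<close> of the solution path has squared uniform error
  \<open>\<delta>\<^sup>2 = O(q\<^sup>2\<^sup>-\<^sup>2\<^sup>\<nu>)\<close> and mean square error \<open>O(q\<^sup>-\<^sup>2\<^sup>\<nu>)\<close>.  Since \<open>C\<^sub>p = q\<close> and the averaged Gram matrix has
  smallest eigenvalue \<open>1 / (2 q - 1)\<close>, the expected squared distance of the iterates to \<open>b\<close> contracts by
  \<open>1 - \<Theta>(q\<^sup>-\<^sup>2)\<close> per step; because \<open>b\<close> is nearly optimal for the sampled \<open>\<lambda>\<close>, the noise floor is
  only \<open>O(q)\<close> times the mean square error, that is \<open>O(q\<^sup>1\<^sup>-\<^sup>2\<^sup>\<nu>)\<close>.  Passing to the supremum over \<open>\<lambda>\<close>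
  costs another factor \<open>q\<close>, so the limiting error is \<open>O(q\<^sup>2\<^sup>-\<^sup>2\<^sup>\<nu>)\<close>, reached after
  \<open>O(q\<^sup>2 log (1 / \<epsilon>))\<close> steps.
\<close>

section \<open>Legendre polynomials\<close>

text \<open>The mean square error of \<open>b\<close> has to be estimated separately. If the noise
  floor were charged with the squared uniform error, the final bound would be of order q^(4 - 2
  \<nu>), which does not even tend to 0 for \<nu> = 2. The two powers are gained by Parseval: the
  coefficient of index n, of size n^(-\<nu>), enters the mean square through its square divided by 2
  n + 1, but the uniform error through its absolute value.

  The initial point is free and its dimension changes with q. Polynomial growth of its norm is
  enough: the initial error is multiplied by an exponentially small factor, so a power of q only
  costs a constant factor in the logarithm inside T. The array \<open>b\<close> is fixed and
  bounded, and each q reads a truncation of it, so its norm grows polynomially as well.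

  For each \<theta>, \<open>h\<close> is only assumed measurable in \<lambda>. Measurability of
  gradients, iterates and the supremum therefore rests on continuity in \<theta> or in the
  coefficients.\<close>

fun legendre_poly :: "nat \<Rightarrow> real poly" where
  "legendre_poly 0 = 1"
| "legendre_poly (Suc 0) = [:0, 1:]"
| "legendre_poly (Suc (Suc n)) = smult (1 / real (n + 2))
     (smult (real (2 * n + 3)) ([:0, 1:] * legendre_poly (Suc n)) - smult (real (n + 1)) (legendre_poly n))"

lemma poly_legendre_poly [simp]: "poly (legendre_poly n) x = legendre n x"
  by (induction n x rule: legendre.induct) (simp_all add: field_simps)

text \<open>Going through \<open>legendre_poly\<close> makes derivatives of every order available
  from \<open>pderiv\<close>; the energy argument for the bound on \<open>legendre\<close> needs the
  second one.\<close>

definition dlegendre :: "nat \<Rightarrow> real \<Rightarrow> real" where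
  "dlegendre n x = poly (pderiv (legendre_poly n)) x"

lemma DERIV_legendre: "(legendre n has_real_derivative dlegendre n x) (at x within S)"
  using poly_DERIV[of "legendre_poly n" x] has_field_derivative_at_within
  by (force simp: dlegendre_def)

lemmas DERIV_legendre' [derivative_intros] = DERIV_legendre[THEN DERIV_chain2]

lemma continuous_on_legendre [continuous_intros]:
  "continuous_on S f \<Longrightarrow> continuous_on S (\<lambda>x. legendre n (f x))"
  using continuous_on_poly[of S f "legendre_poly n"] by simp

lemma bonnet: "real (n + 2) * legendre (Suc (Suc n)) x =
    real (2 * n + 3) * x * legendre (Suc n) x - real (n + 1) * legendre n x"
  by simp

lemma bonnet_deriv: "real (n + 2) * dlegendre (Suc (Suc n)) x =
    real (2 * n + 3) * (legendre (Suc n) x + x * dlegendre (Suc n) x) - real (n + 1) * dlegendre n x"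
proof (rule DERIV_unique)
  show "((\<lambda>x. real (n + 2) * legendre (Suc (Suc n)) x) has_real_derivative
      real (n + 2) * dlegendre (Suc (Suc n)) x) (at x)"
    by (rule DERIV_cmult[OF DERIV_legendre])
  show "((\<lambda>x. real (n + 2) * legendre (Suc (Suc n)) x) has_real_derivative
      real (2 * n + 3) * (legendre (Suc n) x + x * dlegendre (Suc n) x) - real (n + 1) * dlegendre n x) (at x)"
    unfolding bonnet
    by (rule derivative_eq_intros DERIV_legendre refl)+ (simp add: algebra_simps)
qed

declare legendre.simps(3) [simp del]

lemma dlegendre_0 [simp]: "dlegendre 0 x = 0" and dlegendre_1 [simp]: "dlegendre (Suc 0) x = 1"
  by (simp_all add: dlegendre_def pderiv_pCons)

text \<open>The two identities need each other: the differentiated Bonnet recursion yields the next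
  instance of the first only with the help of the second, and the next instance of the second uses
  both.\<close>

lemma dlegendre_Suc_aux:
  "dlegendre (Suc n) x = x * dlegendre n x + real (n + 1) * legendre n x \<and>
   x * dlegendre (Suc n) x - dlegendre n x = real (n + 1) * legendre (Suc n) x"
proof (induction n)
  case 0
  then show ?case by simp
next
  case (Suc n)
  define a where "a = real n"
  define P0 where "P0 = legendre n x"
  define P1 where "P1 = legendre (Suc n) x"
  define P2 where "P2 = legendre (Suc (Suc n)) x"
  define D0 where "D0 = dlegendre n x"
  define D1 where "D1 = dlegendre (Suc n) x"
  define D2 where "D2 = dlegendre (Suc (Suc n)) x"
  note defs = a_def P0_def P1_def P2_def D0_def D1_def D2_def
  have a: "a \<ge> 0" by (simp add: a_def)
  have 1: "D1 = x * D0 + (a + 1) * P0" and 3: "x * D1 - D0 = (a + 1) * P1"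
    using Suc by (auto simp: defs algebra_simps)
  have B: "(a + 2) * P2 = (2 * a + 3) * x * P1 - (a + 1) * P0"
    using bonnet[of n x] by (simp add: defs algebra_simps)
  have B': "(a + 2) * D2 = (2 * a + 3) * (P1 + x * D1) - (a + 1) * D0"
    using bonnet_deriv[of n x] by (simp add: defs algebra_simps)
  have "(a + 2) * D2 = (a + 2) * (x * D1 + (a + 2) * P1)"
    using B' 3 by algebra
  then have D2: "D2 = x * D1 + (a + 2) * P1" using a by simp
  have "x * D2 - D1 = (a + 2) * P2"
    using B D2 1 3 by algebra
  with D2 show ?case by (simp add: defs algebra_simps)
qed

lemma dlegendre_Suc: "dlegendre (Suc n) x = x * dlegendre n x + real (n + 1) * legendre n x"
  and x_dlegendre_Suc: "x * dlegendre (Suc n) x = dlegendre n x + real (n + 1) * legendre (Suc n) x"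
  using dlegendre_Suc_aux[of n x] by auto

lemma dlegendre_Suc_Suc:
  "dlegendre (Suc (Suc n)) x = dlegendre n x + real (2 * n + 3) * legendre (Suc n) x"
  using dlegendre_Suc[of "Suc n" x] x_dlegendre_Suc[of x n] by (simp add: algebra_simps)

lemma one_minus_square_dlegendre:
  "(1 - x\<^sup>2) * dlegendre (Suc n) x = real (n + 1) * (legendre n x - x * legendre (Suc n) x)"
  using dlegendre_Suc[of n x] x_dlegendre_Suc[of x n] by algebra

text \<open>Legendre's equation in Sturm-Liouville form. It follows by differentiating the preceding
  expression for \<open>(1 - x\<^sup>2) * dlegendre n x\<close>.\<close>

lemma legendre_differential_equation:
  "((\<lambda>x. (1 - x\<^sup>2) * dlegendre n x) has_real_derivative - (real n * real (n + 1) * legendre n x)) (at x within S)"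
proof (cases n)
  case 0
  then show ?thesis by (simp add: dlegendre_def)
next
  case (Suc m)
  have "((\<lambda>x. real (m + 1) * (legendre m x - x * legendre (Suc m) x)) has_real_derivative
      real (m + 1) * (dlegendre m x - (legendre (Suc m) x + x * dlegendre (Suc m) x))) (at x within S)"
    by (auto intro!: derivative_eq_intros)
  also have "real (m + 1) * (dlegendre m x - (legendre (Suc m) x + x * dlegendre (Suc m) x))
      = - (real n * real (n + 1) * legendre n x)"
    using x_dlegendre_Suc[of x m] unfolding Suc by (simp add: algebra_simps)
  finally show ?thesis unfolding Suc one_minus_square_dlegendre .
qed

lemma legendre_minus_1: "legendre n (-1) = (-1) ^ n"
  by (induction n "-1::real" rule: legendre.induct) (simp_all add: legendre.simps(3) field_simps)

text \<open>The energy below has derivative \<open>2 x P\<^sub>n'\<^sup>2 / (n (n + 1))\<close>, so on \<open>[-1, 1]\<close> it is largest at the end points.\<close>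

lemma abs_legendre_le_1:
  assumes "x \<in> {-1..1}" shows "\<bar>legendre n x\<bar> \<le> 1"
proof (cases "n = 0")
  case False
  define N where "N = real n * real (n + 1)"
  have N: "N > 0" using False by (simp add: N_def)
  let ?D = "dlegendre n"
  define E where "E y = poly (pderiv (pderiv (legendre_poly n))) y" for y
  define G where "G y = (legendre n y)\<^sup>2 + (1 - y\<^sup>2) * ?D y * ?D y / N" for y
  have DE: "(?D has_real_derivative E y) (at y)" for y
    using poly_DERIV[of "pderiv (legendre_poly n)" y] by (simp add: E_def dlegendre_def[abs_def])
  have ode: "(1 - y\<^sup>2) * E y - 2 * y * ?D y = - (N * legendre n y)" for y
  proof -
    have "((\<lambda>x. (1 - x\<^sup>2) * ?D x) has_real_derivative (1 - y\<^sup>2) * E y - 2 * y * ?D y) (at y)"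
      by (auto intro!: derivative_eq_intros DE)
    then show ?thesis
      using DERIV_unique[OF _ legendre_differential_equation[of n y UNIV]] by (simp add: N_def)
  qed
  have dG: "(G has_real_derivative 2 * y * (?D y)\<^sup>2 / N) (at y)" for y
  proof -
    have L: "(legendre n has_real_derivative ?D y) (at y)" by (rule DERIV_legendre)
    have "((\<lambda>y. (legendre n y)\<^sup>2 + (1 - y\<^sup>2) * ?D y * ?D y / N) has_real_derivative
        2 * legendre n y * ?D y + (((1 - y\<^sup>2) * E y - 2 * y * ?D y) * ?D y + (1 - y\<^sup>2) * ?D y * E y) / N) (at y)"
      using N by (auto intro!: derivative_eq_intros DE L simp: field_simps)
    also have "2 * legendre n y * ?D y + (((1 - y\<^sup>2) * E y - 2 * y * ?D y) * ?D y + (1 - y\<^sup>2) * ?D y * E y) / N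
        = 2 * y * (?D y)\<^sup>2 / N"
    proof -
      have "N * (2 * legendre n y * ?D y) + (((1 - y\<^sup>2) * E y - 2 * y * ?D y) * ?D y + (1 - y\<^sup>2) * ?D y * E y)
         = 2 * y * (?D y)\<^sup>2"
        using ode[of y] by algebra
      then show ?thesis using N by (simp add: field_simps)
    qed
    finally show ?thesis unfolding G_def[abs_def] .
  qed
  have "G x \<le> 1"
  proof (cases "x \<ge> 0")
    case True
    have "G x \<le> G 1"
    proof (rule DERIV_nonneg_imp_nondecreasing[where f = G])
      fix y assume "x \<le> y"
      with True N have "0 \<le> 2 * y * (?D y)\<^sup>2 / N" by simp
      with dG[of y] show "\<exists>z. (G has_real_derivative z) (at y) \<and> 0 \<le> z" by blast
    qed (use assms in auto)
    then show ?thesis by (simp add: G_def legendre_at_1)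
  next
    case False
    have "G x \<le> G (-1)"
    proof (rule DERIV_nonpos_imp_nonincreasing[where f = G])
      fix y assume "y \<le> x"
      with False N have "2 * y * (?D y)\<^sup>2 / N \<le> 0"
        by (intro divide_nonpos_pos mult_nonpos_nonneg[of "2 * y"]) auto
      with dG[of y] show "\<exists>z. (G has_real_derivative z) (at y) \<and> z \<le> 0" by blast
    qed (use assms in auto)
    then show ?thesis by (simp add: G_def legendre_minus_1 flip: power_mult_distrib power_mult)
  qed
  moreover have "(1 - x\<^sup>2) * ?D x * ?D x / N \<ge> 0"
    unfolding mult.assoc using assms N
    by (intro divide_nonneg_pos mult_nonneg_nonneg zero_le_square) (auto simp: abs_square_le_1)
  ultimately have "(legendre n x)\<^sup>2 \<le> 1" by (simp add: G_def)
  then show ?thesis by (simp add: abs_square_le_1)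
qed simp

section \<open>Orthogonality and norms of the Legendre polynomials\<close>

lemma has_integral_real_derivative:
  fixes f :: "real \<Rightarrow> real"
  assumes "a \<le> b" and "\<And>x. x \<in> {a..b} \<Longrightarrow> (f has_real_derivative f' x) (at x within {a..b})"
  shows "(f' has_integral (f b - f a)) {a..b}"
  by (rule fundamental_theorem_of_calculus)
     (use assms in \<open>auto simp: has_real_derivative_iff_has_vector_derivative\<close>)

lemma integrable_legendre_mult:
  "continuous_on {-1..1} f \<Longrightarrow> (\<lambda>x. f x * legendre n x) integrable_on {-1..1}"
  by (intro integrable_continuous_real continuous_intros)

text \<open>The Wronskian-type expression \<open>?W\<close> vanishes at both end points because of
  the factor \<open>1 - x\<^sup>2\<close>, and by the differential equation its derivative is the
  product times the difference of the two eigenvalues.\<close>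

lemma legendre_orthogonal:
  assumes "m \<noteq> n"
  shows "integral {-1..1} (\<lambda>x. legendre m x * legendre n x) = 0"
proof -
  let ?N = "\<lambda>n. real n * real (n + 1)"
  let ?W = "\<lambda>x. legendre m x * ((1 - x\<^sup>2) * dlegendre n x) - legendre n x * ((1 - x\<^sup>2) * dlegendre m x)"
  have "((\<lambda>x. (?N m - ?N n) * (legendre m x * legendre n x)) has_integral (?W 1 - ?W (-1))) {-1..1}"
  proof (rule has_integral_real_derivative)
    fix x :: real
    show "(?W has_real_derivative (?N m - ?N n) * (legendre m x * legendre n x)) (at x within {-1..1})"
      by (rule derivative_eq_intros DERIV_legendre legendre_differential_equation refl)+
         (simp add: algebra_simps)
  qed simp
  from integral_unique[OF this]
  have "(?N m - ?N n) * integral {-1..1} (\<lambda>x. legendre m x * legendre n x) = 0"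
    unfolding integral_mult_right by simp
  moreover have "?N m \<noteq> ?N n"
  proof -
    have "?N k < ?N l" if "k < l" for k l
      using that by (intro mult_strict_mono) auto
    then show ?thesis using assms by (metis linorder_neqE_nat less_irrefl)
  qed
  ultimately show ?thesis by simp
qed

text \<open>\<open>dlegendre m\<close> is a combination of Legendre polynomials of index below
  \<open>m\<close>, all orthogonal to \<open>legendre n\<close>; the two-step induction spells this
  combination out.\<close>

lemma integral_legendre_mult_dlegendre:
  "m \<le> n \<Longrightarrow> ((\<lambda>x. legendre n x * dlegendre m x) has_integral 0) {-1..1}"
proof (induction m rule: induct_nat_012)
  case (ge2 m)
  have int: "(\<lambda>x. legendre n x * legendre (Suc m) x) integrable_on {-1..1}"
    by (intro integrable_continuous_real continuous_intros)
  then have "((\<lambda>x. legendre n x * legendre (Suc m) x) has_integral 0) {-1..1}"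
    using legendre_orthogonal[of n "Suc m"] ge2.prems by (simp add: has_integral_iff)
  from has_integral_add[OF ge2.IH(1) has_integral_mult_right[OF this, of "real (2 * m + 3)"]] ge2.prems
  show ?case by (simp add: dlegendre_Suc_Suc algebra_simps)
next
  case 1
  have "((\<lambda>x. legendre n x * legendre 0 x) has_integral 0) {-1..1}"
    using legendre_orthogonal[of n 0] 1 by (simp add: has_integral_iff integrable_continuous_real continuous_intros del: legendre.simps)
  then show ?case by simp
qed simp

text \<open>The derivative of x P_n(x)^2 has integral 2. Rewriting x P_n' by
  \<open>x_dlegendre_Suc\<close> turns that integrand into 2 n + 1 times the squared polynomial plus
  a term orthogonal to it.\<close>

lemma legendre_norm: "integral {-1..1} (\<lambda>x. legendre n x * legendre n x) = 2 / real (2 * n + 1)"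
proof (cases n)
  case (Suc m)
  have "((\<lambda>x. (legendre n x * legendre n x) + 2 * (x * dlegendre n x) * legendre n x) has_integral
     1 * legendre n 1 * legendre n 1 - (- 1) * legendre n (-1) * legendre n (-1)) {-1..1}"
    by (rule has_integral_real_derivative) (auto intro!: derivative_eq_intros simp: algebra_simps)
  then have "((\<lambda>x. real (2 * n + 1) * (legendre n x * legendre n x) + 2 * (legendre n x * dlegendre m x))
      has_integral 2) {-1..1}"
    unfolding Suc x_dlegendre_Suc by (simp add: legendre_at_1 legendre_minus_1 algebra_simps flip: power_mult_distrib)
  from has_integral_diff[OF this has_integral_mult_right[OF integral_legendre_mult_dlegendre[of m n], of 2]]
  have "((\<lambda>x. real (2 * n + 1) * (legendre n x * legendre n x)) has_integral 2) {-1..1}"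
    by (simp add: Suc)
  from integral_unique[OF this]
  have "real (2 * n + 1) * integral {-1..1} (\<lambda>x. legendre n x * legendre n x) = 2"
    unfolding integral_mult_right .
  then show ?thesis by (simp add: field_simps)
qed simp

text \<open>The Gram matrix is block diagonal with equal rank-one blocks, so besides 0 only the
  squared norm of the row of Legendre values can be an eigenvalue.\<close>

lemma sigma_max_Phi_gram:
  assumes "0 < q"
  shows "sigma_max (coeff_index q :: ('d::finite \<times> nat) set) (Phi_gram l) = (\<Sum>n<q. (legendre n l)\<^sup>2)"
    (is "_ = ?S")
proof -
  let ?I = "coeff_index q :: ('d \<times> nat) set"
  have gram: "(\<Sum>c'\<in>?I. Phi_gram l (i, n) c' * v c') = legendre n l * (\<Sum>m<q. legendre m l * v (i, m))"
    for i :: 'd and n v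
  proof -
    have "(\<Sum>c'\<in>?I. Phi_gram l (i, n) c' * v c')
        = (\<Sum>j\<in>UNIV. \<Sum>m<q. if j = i then legendre n l * legendre m l * v (j, m) else 0)"
      unfolding coeff_index_def sum.cartesian_product
      by (intro sum.cong) (auto simp: Phi_gram_def Phi_def if_distrib[of "\<lambda>x. x * _"] sum.delta cong: if_cong)
    also have "\<dots> = (\<Sum>j\<in>UNIV. if j = i then \<Sum>m<q. legendre n l * legendre m l * v (j, m) else 0)"
      by (intro sum.cong) auto
    finally show ?thesis by (simp add: sum_distrib_left mult.assoc)
  qed
  \<comment> \<open>Here \<open>0 < q\<close> matters: the constant polynomial is present and makes
    \<open>?S\<close> the larger of the two candidates.\<close>
  have S: "?S \<ge> 1"
  proof -
    have "(legendre 0 l)\<^sup>2 \<le> ?S" using assms by (intro member_le_sum) auto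
    then show ?thesis by simp
  qed
  \<comment> \<open>This also supplies finiteness of the spectrum, without which the
    \<open>Max\<close> in \<open>sigma_max\<close> would be unspecified.\<close>
  have sub: "{r. eigenvalue_on ?I (Phi_gram l) r} \<subseteq> {0, ?S}"
  proof (intro subsetI CollectI, elim CollectE)
    fix r assume "eigenvalue_on ?I (Phi_gram l) r"
    then obtain v i n where eq: "\<forall>c\<in>?I. (\<Sum>c'\<in>?I. Phi_gram l c c' * v c') = r * v c"
      and c: "(i, n) \<in> ?I" "v (i, n) \<noteq> 0"
      unfolding eigenvalue_on_def by auto
    define s where "s = (\<Sum>m<q. legendre m l * v (i, m))"
    have v: "legendre m l * s = r * v (i, m)" if "m < q" for m
      using eq that by (auto simp: gram[symmetric] s_def coeff_index_def)
    have "?S * s = (\<Sum>m<q. legendre m l * (legendre m l * s))"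
      by (simp add: sum_distrib_right power2_eq_square mult.assoc)
    also have "\<dots> = (\<Sum>m<q. legendre m l * (r * v (i, m)))"
      using v by (intro sum.cong) auto
    also have "\<dots> = r * s" by (simp add: s_def sum_distrib_left mult_ac)
    finally have "s = 0 \<or> r = ?S" by auto
    with v[of n] c show "r \<in> {0, ?S}" by (auto simp: coeff_index_def)
  qed
  have "eigenvalue_on ?I (Phi_gram l) ?S"
    unfolding eigenvalue_on_def
  proof (intro exI[of _ "\<lambda>(i, n). legendre n l"] conjI)
    show "\<exists>c\<in>?I. (case c of (i, n) \<Rightarrow> legendre n l) \<noteq> 0"
      using assms by (auto simp: coeff_index_def intro!: bexI[of _ 0])
    show "\<forall>c\<in>?I. (\<Sum>c'\<in>?I. Phi_gram l c c' * (case c' of (i, n) \<Rightarrow> legendre n l))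
        = ?S * (case c of (i, n) \<Rightarrow> legendre n l)"
      by (auto simp: gram power2_eq_square mult.commute)
  qed
  then show ?thesis
    unfolding sigma_max_def using S
    by (intro Max_eqI finite_subset[OF sub]) (use sub in auto)
qed

lemma sum_legendre_squares_le: "l \<in> {-1..1} \<Longrightarrow> (\<Sum>n<q. (legendre n l)\<^sup>2) \<le> real q"
  using sum_mono[of "{..<q}" "\<lambda>n. (legendre n l)\<^sup>2" "\<lambda>_. 1"] abs_legendre_le_1
  by (simp add: abs_square_le_1)

text \<open>Every square is at most 1 on the interval and all of them equal 1 at
  \<open>l = 1\<close>, where the supremum is attained.\<close>

lemma C_p_eq: "0 < q \<Longrightarrow> C_p TYPE('d::finite) q = real q"
  unfolding C_p_def
  by (intro cSup_eq_maximum)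
     (auto simp: sigma_max_Phi_gram legendre_at_1 intro!: sum_legendre_squares_le rev_image_eqI[of 1])

section \<open>Decay of Legendre coefficients\<close>

text \<open>Jordan decomposition, with \<open>v x\<close> the variation of \<open>g\<close> over
  \<open>{a..x}\<close>. Only the monotonicity of the two parts is recorded, as the second mean
  value theorem asks for no more.\<close>

lemma monotone_decomposition:
  fixes g :: "real \<Rightarrow> real"
  assumes "total_variation {a..b} g \<le> ereal V"
  obtains v :: "real \<Rightarrow> real"
  where "\<And>x y. \<lbrakk>a \<le> x; x \<le> y; y \<le> b\<rbrakk> \<Longrightarrow> v x \<le> v y"
    and "\<And>x y. \<lbrakk>a \<le> x; x \<le> y; y \<le> b\<rbrakk> \<Longrightarrow> v x - g x \<le> v y - g y"
proof -
  define S where "S \<D> = (\<Sum>K\<in>\<D>. \<bar>g (Sup K) - g (Inf K)\<bar>)" for \<D> :: "real set set"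
  define v where "v x = (SUP \<D>\<in>{\<D>. \<D> division_of {a..x}}. S \<D>)" for x
  have insert: "insert {x..y} \<D> division_of {a..y}" "S (insert {x..y} \<D>) = S \<D> + \<bar>g y - g x\<bar>"
    if D: "\<D> division_of {a..x}" and xy: "a \<le> x" "x < y" for \<D> x y
  proof -
    have "{{x..y}} division_of {x..y}"
      using division_of_self[of x y] xy by auto
    from division_disjoint_union[OF this D]
    have "insert {x..y} \<D> division_of {x..y} \<union> {a..x}"
      by (auto simp: interior_atLeastAtMost_real)
    also have "{x..y} \<union> {a..x} = {a..y}" using xy by auto
    finally show "insert {x..y} \<D> division_of {a..y}" .
    have "{x..y} \<notin> \<D>"
    proof
      assume "{x..y} \<in> \<D>"
      then have "{x..y} \<subseteq> {a..x}" using D by (auto dest: division_ofD(2))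
      then show False using xy by auto
    qed
    moreover have "finite \<D>" using D by (rule division_of_finite)
    ultimately show "S (insert {x..y} \<D>) = S \<D> + \<bar>g y - g x\<bar>"
      using xy by (simp add: S_def)
  qed
  have leV: "S \<D> \<le> V" if D: "\<D> division_of {a..x}" and x: "a \<le> x" "x \<le> b" for \<D> x
  proof -
    have *: "S \<E> \<le> V" if "\<E> division_of {a..b}" for \<E>
    proof -
      have "ereal (S \<E>) \<le> total_variation {a..b} g"
        unfolding total_variation_def S_def using that by (intro SUP_upper) auto
      with assms show ?thesis by (metis ereal_less_eq(3) order_trans)
    qed
    show ?thesis
    proof (cases "x = b")
      case False
      with insert[OF D x(1), of b] *[of "insert {x..b} \<D>"] x show ?thesis by auto
    qed (use * D in auto)
  qed
  have bdd: "bdd_above (S ` {\<D>. \<D> division_of {a..x}})" if "a \<le> x" "x \<le> b" for x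
    using leV that by (auto intro!: bdd_aboveI[of _ V])
  have ne: "{\<D>. \<D> division_of {a..x}} \<noteq> {}" if "a \<le> x" for x
    using division_of_self[of a x] that by auto
  \<comment> \<open>The absolute value covers both signs of the increment, so both monotonicity
    claims follow at once.\<close>
  have key: "v x + \<bar>g y - g x\<bar> \<le> v y" if "a \<le> x" "x \<le> y" "y \<le> b" for x y
  proof (cases "x = y")
    case False
    have "v x \<le> v y - \<bar>g y - g x\<bar>"
      unfolding v_def[of x]
    proof (rule cSUP_least[OF ne[OF that(1)]])
      fix \<D> assume "\<D> \<in> {\<D>. \<D> division_of {a..x}}"
      then have "\<D> division_of {a..x}" by simp
      from insert[OF this that(1), of y] False that
      have *: "insert {x..y} \<D> division_of {a..y}" "S (insert {x..y} \<D>) = S \<D> + \<bar>g y - g x\<bar>" by auto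
      have "S (insert {x..y} \<D>) \<le> v y"
        unfolding v_def using that * by (intro cSUP_upper bdd) auto
      with * show "S \<D> \<le> v y - \<bar>g y - g x\<bar>" by simp
    qed
    then show ?thesis by simp
  qed simp
  show thesis
  proof (rule that[of v])
    fix x y assume "a \<le> x" "x \<le> y" "y \<le> b"
    from key[OF this] show "v x \<le> v y" "v x - g x \<le> v y - g y" by linarith+
  qed
qed

text \<open>This particular antiderivative vanishes at both end points, so integration by parts
  against it leaves no boundary terms.\<close>

lemma DERIV_legendre_antiderivative:
  "((\<lambda>x. (legendre (Suc (Suc n)) x - legendre n x) / real (2 * n + 3)) has_real_derivative
     legendre (Suc n) x) (at x within S)"
  by (rule derivative_eq_intros DERIV_legendre refl)+ (simp_all add: dlegendre_Suc_Suc)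

text \<open>The antiderivative is a difference of two polynomials bounded by 1, divided by 2 n + 1.
  For \<open>n = 0\<close> it has no lower neighbour, and the length of the interval is used
  instead.\<close>

lemma abs_integral_legendre_le:
  assumes "-1 \<le> a" "a \<le> c" "c \<le> 1"
  shows "\<bar>integral {a..c} (legendre n)\<bar> \<le> 4 / real (n + 1)"
proof (cases n)
  case 0
  moreover have "legendre 0 = (\<lambda>_. 1)" by auto
  ultimately show ?thesis using assms by simp
next
  case (Suc m)
  define Q where "Q x = (legendre (Suc (Suc m)) x - legendre m x) / real (2 * m + 3)" for x
  have "(legendre n has_integral (Q c - Q a)) {a..c}"
    unfolding Suc Q_def using assms(2)
    by (intro fundamental_theorem_of_calculus
          DERIV_legendre_antiderivative[unfolded has_real_derivative_iff_has_vector_derivative])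
  then have "integral {a..c} (legendre n) = Q c - Q a" by (rule integral_unique)
  also have "\<bar>\<dots>\<bar> \<le> \<bar>Q c\<bar> + \<bar>Q a\<bar>" by simp
  also have "\<bar>Q x\<bar> \<le> 2 / real (n + 1)" if "x \<in> {-1..1}" for x
  proof -
    have "\<bar>Q x\<bar> = \<bar>legendre (Suc (Suc m)) x - legendre m x\<bar> / real (2 * m + 3)" by (simp add: Q_def)
    also have "\<dots> \<le> 2 / real (n + 1)"
      using abs_legendre_le_1[OF that, of "Suc (Suc m)"] abs_legendre_le_1[OF that, of m]
      by (intro frac_le) (auto simp: Suc)
    finally show ?thesis .
  qed
  then have "\<bar>Q c\<bar> + \<bar>Q a\<bar> \<le> 2 / real (n + 1) + 2 / real (n + 1)"
    using assms by (intro add_mono) auto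
  finally show ?thesis by (simp flip: add_divide_distrib)
qed

text \<open>The second mean value theorem replaces \<open>g\<close> by its two end values, leaving
  integrals of \<open>legendre n\<close> over subintervals. This yields one power of
  \<open>1 / (n + 1)\<close> without continuity of \<open>g\<close>.\<close>

lemma monotone_mult_legendre:
  fixes g :: "real \<Rightarrow> real"
  assumes "\<And>x y. \<lbrakk>-1 \<le> x; x \<le> y; y \<le> 1\<rbrakk> \<Longrightarrow> g x \<le> g y"
  shows "(\<lambda>x. g x * legendre n x) integrable_on {-1..1}"
    and "\<bar>integral {-1..1} (\<lambda>x. g x * legendre n x)\<bar> \<le> 4 * (\<bar>g (-1)\<bar> + \<bar>g 1\<bar>) / real (n + 1)"
proof -
  have "legendre n integrable_on {-1..1}"
    by (intro integrable_continuous_real continuous_intros)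
  from second_mean_value_theorem_full[where g = g, OF this _ assms] obtain c where c: "c \<in> {-1..1}"
    and I: "((\<lambda>x. g x * legendre n x) has_integral
      (g (-1) * integral {-1..c} (legendre n) + g 1 * integral {c..1} (legendre n))) {-1..1}" by auto
  show "(\<lambda>x. g x * legendre n x) integrable_on {-1..1}" using I by blast
  have "\<bar>integral {-1..1} (\<lambda>x. g x * legendre n x)\<bar>
      \<le> \<bar>g (-1)\<bar> * \<bar>integral {-1..c} (legendre n)\<bar> + \<bar>g 1\<bar> * \<bar>integral {c..1} (legendre n)\<bar>"
    unfolding integral_unique[OF I] abs_mult[symmetric] by (rule abs_triangle_ineq)
  also have "\<dots> \<le> \<bar>g (-1)\<bar> * (4 / real (n + 1)) + \<bar>g 1\<bar> * (4 / real (n + 1))"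
    using c by (intro add_mono mult_left_mono abs_integral_legendre_le) auto
  finally show "\<bar>integral {-1..1} (\<lambda>x. g x * legendre n x)\<bar> \<le> 4 * (\<bar>g (-1)\<bar> + \<bar>g 1\<bar>) / real (n + 1)"
    by (simp add: add_divide_distrib algebra_simps)
qed

text \<open>Both parts of the Jordan decomposition are monotone; their end values give the constant,
  which depends on \<open>g\<close> but not on \<open>n\<close>.\<close>

lemma bounded_variation_mult_legendre:
  fixes g :: "real \<Rightarrow> real"
  assumes "total_variation {-1..1} g \<le> ereal V"
  shows "(\<lambda>x. g x * legendre n x) integrable_on {-1..1}"
    and "\<exists>K. \<forall>n. \<bar>integral {-1..1} (\<lambda>x. g x * legendre n x)\<bar> \<le> K / real (n + 1)"
proof -
  obtain v where v: "\<And>x y. \<lbrakk>-1 \<le> x; x \<le> y; y \<le> 1\<rbrakk> \<Longrightarrow> v x \<le> v y"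
    and vg: "\<And>x y. \<lbrakk>-1 \<le> x; x \<le> y; y \<le> 1\<rbrakk> \<Longrightarrow> v x - g x \<le> v y - g y"
    using monotone_decomposition[OF assms] by metis
  define u where "u x = v x - g x" for x
  have u: "\<And>x y. \<lbrakk>-1 \<le> x; x \<le> y; y \<le> 1\<rbrakk> \<Longrightarrow> u x \<le> u y" using vg by (simp add: u_def)
  note iv = monotone_mult_legendre[of v, OF v] and iu = monotone_mult_legendre[of u, OF u]
  have eq: "g x * legendre n x = v x * legendre n x - u x * legendre n x" for x n
    by (simp add: u_def algebra_simps)
  show "(\<lambda>x. g x * legendre n x) integrable_on {-1..1}"
    unfolding eq by (intro integrable_diff iv iu) auto
  let ?K = "4 * (\<bar>v (-1)\<bar> + \<bar>v 1\<bar>) + 4 * (\<bar>u (-1)\<bar> + \<bar>u 1\<bar>)"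
  have "\<bar>integral {-1..1} (\<lambda>x. g x * legendre n x)\<bar> \<le> ?K / real (n + 1)" for n
  proof -
    have "integral {-1..1} (\<lambda>x. g x * legendre n x)
       = integral {-1..1} (\<lambda>x. v x * legendre n x) - integral {-1..1} (\<lambda>x. u x * legendre n x)"
      unfolding eq by (intro Henstock_Kurzweil_Integration.integral_diff iv iu) auto
    then show ?thesis
      using iv(2)[of n] iu(2)[of n] unfolding add_divide_distrib by linarith
  qed
  then show "\<exists>K. \<forall>n. \<bar>integral {-1..1} (\<lambda>x. g x * legendre n x)\<bar> \<le> K / real (n + 1)" by blast
qed

text \<open>Integrability of \<open>f'\<close> against Legendre polynomials is a hypothesis because
  for the last derivative of the solution path it is obtained from bounded variation, not from
  continuity.\<close>

lemma integral_mult_legendre_by_parts: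
  fixes f f' :: "real \<Rightarrow> real"
  assumes f: "\<And>x. x \<in> {-1..1} \<Longrightarrow> (f has_real_derivative f' x) (at x within {-1..1})"
    and f': "\<And>n. (\<lambda>x. f' x * legendre n x) integrable_on {-1..1}"
  shows "integral {-1..1} (\<lambda>x. f x * legendre (Suc n) x) =
    (integral {-1..1} (\<lambda>x. f' x * legendre n x) - integral {-1..1} (\<lambda>x. f' x * legendre (Suc (Suc n)) x))
      / real (2 * n + 3)"
proof -
  define Q where "Q x = (legendre (Suc (Suc n)) x - legendre n x) / real (2 * n + 3)" for x
  have "continuous_on {-1..1} f" using f DERIV_continuous_on by blast
  then have int: "(\<lambda>x. f x * legendre (Suc n) x) integrable_on {-1..1}" by (rule integrable_legendre_mult)
  have "((\<lambda>x. f' x * Q x + f x * legendre (Suc n) x) has_integral (f 1 * Q 1 - f (-1) * Q (-1))) {-1..1}"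
  proof (rule has_integral_real_derivative)
    fix x :: real assume "x \<in> {-1..1}"
    from DERIV_mult[OF f[OF this] DERIV_legendre_antiderivative]
    show "((\<lambda>x. f x * Q x) has_real_derivative f' x * Q x + f x * legendre (Suc n) x) (at x within {-1..1})"
      unfolding Q_def by (simp add: mult.commute)
  qed simp
  moreover have "Q 1 = 0" "Q (-1) = 0" by (simp_all add: Q_def legendre_at_1 legendre_minus_1)
  ultimately have 1: "((\<lambda>x. f' x * Q x + f x * legendre (Suc n) x) has_integral 0) {-1..1}" by simp
  have Q: "f' x * Q x = (f' x * legendre (Suc (Suc n)) x - f' x * legendre n x) / real (2 * n + 3)" for x
    by (simp add: Q_def field_simps)
  have 2: "((\<lambda>x. f' x * Q x) has_integral
     (integral {-1..1} (\<lambda>x. f' x * legendre (Suc (Suc n)) x) - integral {-1..1} (\<lambda>x. f' x * legendre n x))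
       / real (2 * n + 3)) {-1..1}"
    unfolding Q by (intro has_integral_divide has_integral_diff integrable_integral f')
  show ?thesis
    using integral_unique[OF has_integral_diff[OF 1 2]] by (simp add: minus_divide_left)
qed

text \<open>Of the \<nu> + 1 powers, one comes from the bounded variation of \<open>D \<nu>\<close>
  and one from each of \<nu> integrations by parts; the induction descends from
  \<open>D \<nu>\<close> to \<open>D 0\<close>.\<close>

lemma legendre_coefficient_decay:
  assumes "derivatives_bv \<nu> V f"
  shows "\<exists>K. \<forall>n. \<bar>integral {-1..1} (\<lambda>x. f x * legendre n x)\<bar> \<le> K / real (n + 1) ^ (\<nu> + 1)"
proof -
  obtain D where D0: "\<And>x. x \<in> {-1..1} \<Longrightarrow> D 0 x = f x"
    and D: "\<And>j x. \<lbrakk>j < \<nu>; x \<in> {-1..1}\<rbrakk> \<Longrightarrow> (D j has_real_derivative D (Suc j) x) (at x within {-1..1})"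
    and DV: "total_variation {-1..1} (D \<nu>) \<le> ereal V"
    using assms unfolding derivatives_bv_def by blast
  have int: "(\<lambda>x. D j x * legendre n x) integrable_on {-1..1}" if "j \<le> \<nu>" for j n
  proof (cases "j = \<nu>")
    case True
    then show ?thesis using bounded_variation_mult_legendre(1)[OF DV] by simp
  next
    case False
    with that have "j < \<nu>" by simp
    from D[OF this] have "continuous_on {-1..1} (D j)" by (rule DERIV_continuous_on)
    then show ?thesis by (rule integrable_legendre_mult)
  qed
  define c where "c j n = integral {-1..1} (\<lambda>x. D j x * legendre n x)" for j n
  have "m \<le> \<nu> \<Longrightarrow> \<exists>K. \<forall>n. \<bar>c (\<nu> - m) n\<bar> \<le> K / real (n + 1) ^ (m + 1)" for m
  proof (induction m)
    case 0
    then show ?case using bounded_variation_mult_legendre(2)[OF DV] by (simp add: c_def)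
  next
    case (Suc m)
    then obtain K where K: "\<And>n. \<bar>c (\<nu> - m) n\<bar> \<le> K / real (n + 1) ^ (m + 1)" by auto
    define j where "j = \<nu> - Suc m"
    have j: "j < \<nu>" "\<nu> - m = Suc j" using Suc.prems by (auto simp: j_def)
    have K0: "K \<ge> 0" using K[of 0] by simp
    \<comment> \<open>The first entry covers \<open>n = 0\<close>, where integration by parts does
      not apply. In the second, one factor 2 counts the two neighbouring indices, and
      \<open>2 ^ (m + 2)\<close> pays for replacing \<open>k + 1\<close> by
      \<open>n + 1 = k + 2\<close>, which is at most \<open>2 * (k + 1)\<close>.\<close>
    let ?K = "max \<bar>c j 0\<bar> (2 ^ (m + 3) * K)"
    have "\<bar>c j n\<bar> \<le> ?K / real (n + 1) ^ (Suc m + 1)" for n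
    proof (cases n)
      case (Suc k)
      have "c j n = (c (Suc j) k - c (Suc j) (Suc (Suc k))) / real (2 * k + 3)"
        unfolding c_def Suc using j by (intro integral_mult_legendre_by_parts D int) auto
      then have "\<bar>c j n\<bar> = \<bar>c (Suc j) k - c (Suc j) (Suc (Suc k))\<bar> / real (2 * k + 3)" by simp
      also have "\<dots> \<le> (\<bar>c (Suc j) k\<bar> + \<bar>c (Suc j) (Suc (Suc k))\<bar>) / real (2 * k + 3)"
        by (intro divide_right_mono) auto
      also have "\<dots> \<le> (K / real (k + 1) ^ (m + 1) + K / real (k + 1) ^ (m + 1)) / real (2 * k + 3)"
      proof (intro divide_right_mono add_mono)
        show "\<bar>c (Suc j) k\<bar> \<le> K / real (k + 1) ^ (m + 1)" using K[of k] j by simp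
        have "\<bar>c (Suc j) (Suc (Suc k))\<bar> \<le> K / real (Suc (Suc k) + 1) ^ (m + 1)"
          using K[of "Suc (Suc k)"] j by simp
        also have "\<dots> \<le> K / real (k + 1) ^ (m + 1)"
          using K0 by (intro divide_left_mono power_mono) auto
        finally show "\<bar>c (Suc j) (Suc (Suc k))\<bar> \<le> K / real (k + 1) ^ (m + 1)" .
      qed auto
      also have "\<dots> = 2 * K / (real (2 * k + 3) * real (k + 1) ^ (m + 1))" by simp
      also have "\<dots> \<le> 2 * K / (real (k + 1) * real (k + 1) ^ (m + 1))"
        using K0 by (intro divide_left_mono mult_right_mono) auto
      also have "\<dots> = 2 ^ (m + 2) * (2 * K) / (real (2 * (k + 1))) ^ (m + 2)"
      proof -
        have "real (2 * (k + 1)) ^ (m + 2) = 2 ^ (m + 2) * (real (k + 1) * real (k + 1) ^ (m + 1))"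
          by (simp only: of_nat_mult power_mult_distrib) simp
        then show ?thesis by simp
      qed
      also have "\<dots> \<le> 2 ^ (m + 2) * (2 * K) / (real (n + 1)) ^ (m + 2)"
        using K0 unfolding Suc by (intro divide_left_mono power_mono) auto
      also have "\<dots> \<le> ?K / (real (n + 1)) ^ (m + 2)"
        by (intro divide_right_mono) (auto simp: power_add)
      finally show ?thesis by simp
    qed simp
    then show ?case unfolding j_def by blast
  qed
  from this[of \<nu>] obtain K where K: "\<And>n. \<bar>c 0 n\<bar> \<le> K / real (n + 1) ^ (\<nu> + 1)" by auto
  have "c 0 n = integral {-1..1} (\<lambda>x. f x * legendre n x)" for n
    unfolding c_def using D0 by (intro integral_cong) auto
  with K show ?thesis by auto
qed

section \<open>Convergence of Legendre expansions\<close>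

text \<open>Completeness among continuous functions: Bonnet's recursion leads from Legendre
  polynomials to monomials, and Weierstrass approximation from polynomials to \<open>u\<close>
  itself.\<close>

lemma orthogonal_to_legendre_imp_zero:
  fixes u :: "real \<Rightarrow> real"
  assumes cont: "continuous_on {-1..1} u"
    and orth: "\<And>m. integral {-1..1} (\<lambda>x. u x * legendre m x) = 0"
    and x: "x \<in> {-1..1}"
  shows "u x = 0"
proof -
  \<comment> \<open>Multiplying \<open>legendre m\<close> by x gives a combination of its
    neighbours, so the induction on \<open>k\<close> must keep \<open>m\<close> arbitrary.\<close>
  have pow: "((\<lambda>x. u x * x ^ k * legendre m x) has_integral 0) {-1..1}" for k m
  proof (induction k arbitrary: m)
    case 0
    then show ?case
      using integrable_integral[OF integrable_legendre_mult[OF cont]] by (simp add: orth)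
  next
    case (Suc k)
    show ?case
    proof (cases m)
      case 0
      then show ?thesis using Suc[of 1] by (simp add: mult_ac)
    next
      case (Suc n)
      have "((\<lambda>x. (real (n + 2) * (u x * x ^ k * legendre (Suc (Suc n)) x)
           + real (n + 1) * (u x * x ^ k * legendre n x)) / real (2 * n + 3)) has_integral
           (real (n + 2) * 0 + real (n + 1) * 0) / real (2 * n + 3)) {-1..1}"
        by (intro has_integral_divide has_integral_add has_integral_mult_right Suc.IH)
      moreover have "(real (n + 2) * (u x * x ^ k * legendre (Suc (Suc n)) x)
           + real (n + 1) * (u x * x ^ k * legendre n x)) / real (2 * n + 3) = u x * x ^ Suc k * legendre m x" for x
      proof -
        have "real (n + 2) * (u x * x ^ k * legendre (Suc (Suc n)) x) + real (n + 1) * (u x * x ^ k * legendre n x)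
          = u x * x ^ k * (real (n + 2) * legendre (Suc (Suc n)) x + real (n + 1) * legendre n x)"
          by (simp add: algebra_simps)
        then show ?thesis unfolding bonnet by (simp add: Suc field_simps)
      qed
      ultimately show ?thesis by simp
    qed
  qed
  have poly: "((\<lambda>x. u x * p x) has_integral 0) {-1..1}" if p: "polynomial_function p" for p :: "real \<Rightarrow> real"
  proof -
    from p obtain a n where p: "p = (\<lambda>x. \<Sum>i\<le>n. a i * x ^ i)"
      by (auto simp: real_polynomial_function_iff_sum simp flip: real_polynomial_function_eq)
    have "((\<lambda>x. \<Sum>i\<le>n. a i * (u x * x ^ i * legendre 0 x)) has_integral (\<Sum>i\<le>n. a i * 0)) {-1..1}"
      by (intro has_integral_sum has_integral_mult_right pow) auto
    then show ?thesis by (simp add: p sum_distrib_left mult_ac)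
  qed
  define A where "A = integral {-1..1} (\<lambda>x. \<bar>u x\<bar>)"
  have intA: "(\<lambda>x. e * \<bar>u x\<bar>) integrable_on {-1..1}" for e
    by (intro integrable_continuous_real continuous_intros cont)
  have intu: "(\<lambda>x. u x * u x) integrable_on {-1..1}"
    by (intro integrable_continuous_real continuous_intros cont)
  have "A \<ge> 0" unfolding A_def by (intro integral_nonneg) (use intA[of 1] in auto)
  have le: "integral {-1..1} (\<lambda>x. u x * u x) \<le> e * A" if e: "e > 0" for e
  proof -
    obtain p where p: "polynomial_function p" and pe: "\<And>x. x \<in> {-1..1} \<Longrightarrow> norm (u x - p x) < e"
      using Stone_Weierstrass_polynomial_function[OF _ cont e] by auto
    have "((\<lambda>x. u x * u x - u x * p x) has_integral integral {-1..1} (\<lambda>x. u x * u x) - 0) {-1..1}"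
      by (intro has_integral_diff integrable_integral intu poly p)
    from integral_unique[OF this]
    have "integral {-1..1} (\<lambda>x. u x * u x) = integral {-1..1} (\<lambda>x. u x * u x - u x * p x)" by simp
    also have "\<dots> \<le> integral {-1..1} (\<lambda>x. e * \<bar>u x\<bar>)"
    proof (rule Henstock_Kurzweil_Integration.integral_le)
      show "(\<lambda>x. u x * u x - u x * p x) integrable_on {-1..1}"
        by (intro integrable_diff intu has_integral_integrable[OF poly[OF p]])
      fix x :: real assume "x \<in> {-1..1}"
      then have "\<bar>u x\<bar> * \<bar>u x - p x\<bar> \<le> \<bar>u x\<bar> * e" using pe[of x] by (intro mult_left_mono) auto
      moreover have "u x * u x - u x * p x \<le> \<bar>u x\<bar> * \<bar>u x - p x\<bar>"
        unfolding abs_mult[symmetric] right_diff_distrib by (rule abs_ge_self)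
      ultimately show "u x * u x - u x * p x \<le> e * \<bar>u x\<bar>" by (simp add: mult.commute)
    qed (rule intA)
    finally show ?thesis by (simp add: A_def)
  qed
  have "integral {-1..1} (\<lambda>x. u x * u x) \<le> 0"
  proof (rule field_le_epsilon)
    fix e :: real assume "e > 0"
    \<comment> \<open>Dividing by \<open>A + 1\<close> avoids a case distinction on
      \<open>A = 0\<close>.\<close>
    then have "integral {-1..1} (\<lambda>x. u x * u x) \<le> e / (A + 1) * A"
      using \<open>A \<ge> 0\<close> by (intro le) simp
    also have "\<dots> \<le> e" using \<open>e > 0\<close> \<open>A \<ge> 0\<close> by (simp add: field_simps)
    finally show "integral {-1..1} (\<lambda>x. u x * u x) \<le> 0 + e" by simp
  qed
  moreover have "integral {-1..1} (\<lambda>x. u x * u x) \<ge> 0"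
    by (intro integral_nonneg intu) simp
  ultimately have "((\<lambda>x. u x * u x) has_integral 0) {-1..1}"
    using integrable_integral[OF intu] by simp
  then have "u x * u x = 0"
    using x by (intro has_integral_0_cbox_imp_0[of "-1" 1 "\<lambda>x. u x * u x"])
       (auto intro!: continuous_intros cont)
  then show ?thesis by simp
qed

text \<open>Comparison with the telescoping series of 1 / (n (n + 1)); the subtracted end term lets
  the induction close.\<close>

lemma sum_inverse_squares_le:
  assumes "0 < q" "q \<le> N"
  shows "(\<Sum>n\<in>{q..<N}. 1 / real (n + 1) ^ 2) \<le> 1 / real q - 1 / real N"
  using assms(2)
proof (induction N rule: dec_induct)
  case (step N)
  have "1 / real (N + 1) ^ 2 \<le> 1 / (real N * real (N + 1))"
    using step assms by (intro frac_le) (auto simp: power2_eq_square intro!: mult_right_mono)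
  also have "\<dots> = 1 / real N - 1 / real (Suc N)"
    using step assms by (simp add: field_simps)
  finally have "1 / real (N + 1) ^ 2 \<le> 1 / real N - 1 / real (Suc N)" .
  then show ?case using step by simp
qed simp

lemma sum_inverse_powers_le:
  assumes "0 < q" "2 \<le> m"
  shows "(\<Sum>n\<in>{q..<N}. 1 / real (n + 1) ^ m) \<le> 1 / real q ^ (m - 1)"
proof (cases "q \<le> N")
  case True
  have "(\<Sum>n\<in>{q..<N}. 1 / real (n + 1) ^ m) \<le> (\<Sum>n\<in>{q..<N}. 1 / real q ^ (m - 2) * (1 / real (n + 1) ^ 2))"
  proof (rule sum_mono)
    fix n assume n: "n \<in> {q..<N}"
    have "1 / real (n + 1) ^ m = 1 / (real (n + 1) ^ (m - 2) * real (n + 1) ^ 2)"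
      by (simp only: power_add[symmetric] le_add_diff_inverse2[OF assms(2)])
    also have "\<dots> \<le> 1 / (real q ^ (m - 2) * real (n + 1) ^ 2)"
      using n assms by (intro divide_left_mono mult_right_mono power_mono) auto
    finally show "1 / real (n + 1) ^ m \<le> 1 / real q ^ (m - 2) * (1 / real (n + 1) ^ 2)" by simp
  qed
  also have "\<dots> = 1 / real q ^ (m - 2) * (\<Sum>n\<in>{q..<N}. 1 / real (n + 1) ^ 2)"
    by (simp add: sum_distrib_left)
  also have "\<dots> \<le> 1 / real q ^ (m - 2) * (1 / real q)"
    using sum_inverse_squares_le[OF assms(1) True]
    by (intro mult_left_mono) (auto intro: order_trans)
  also have "\<dots> = 1 / real q ^ Suc (m - 2)" by simp
  also have "Suc (m - 2) = m - 1" using assms by simp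
  finally show ?thesis .
qed simp

section \<open>Uniform and mean square error of the truncated expansion\<close>

locale legendre_series =
  fixes f :: "real \<Rightarrow> real" and K :: real and \<nu> :: nat
  assumes cont: "continuous_on {-1..1} f" and \<nu>: "2 \<le> \<nu>"
    and decay: "\<And>n. \<bar>integral {-1..1} (\<lambda>x. f x * legendre n x)\<bar> \<le> K / real (n + 1) ^ (\<nu> + 1)"
begin

definition coeff :: "nat \<Rightarrow> real" where
  "coeff n = real (2 * n + 1) / 2 * integral {-1..1} (\<lambda>x. f x * legendre n x)"

definition partial_sum :: "nat \<Rightarrow> real \<Rightarrow> real" where
  "partial_sum q x = (\<Sum>n<q. coeff n * legendre n x)"

lemma K_nonneg: "K \<ge> 0"
  using order_trans[OF abs_ge_zero decay[of 0]] by simp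

text \<open>The normalising factor is at most \<open>n + 1\<close> and uses up one of the \<nu> + 1
  powers.\<close>

lemma abs_coeff_le: "\<bar>coeff n\<bar> \<le> K / real (n + 1) ^ \<nu>"
proof -
  have "\<bar>coeff n\<bar> \<le> real (n + 1) * (K / real (n + 1) ^ (\<nu> + 1))"
    unfolding coeff_def abs_mult by (intro mult_mono decay) auto
  also have "\<dots> = K / real (n + 1) ^ \<nu>" by simp
  finally show ?thesis .
qed

lemma abs_coeff_le_K: "\<bar>coeff n\<bar> \<le> K"
proof -
  have "K / real (n + 1) ^ \<nu> \<le> K / 1"
    using K_nonneg by (intro divide_left_mono one_le_power) auto
  with abs_coeff_le[of n] show ?thesis by simp
qed

lemma continuous_on_partial_sum [continuous_intros]: "continuous_on S (partial_sum q)"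
  unfolding partial_sum_def by (intro continuous_intros)

lemma integral_partial_sum_mult:
  "((\<lambda>x. partial_sum q x * legendre m x) has_integral
     (if m < q then integral {-1..1} (\<lambda>x. f x * legendre m x) else 0)) {-1..1}"
proof -
  have "((\<lambda>x. \<Sum>n<q. coeff n * (legendre n x * legendre m x)) has_integral
     (\<Sum>n<q. coeff n * integral {-1..1} (\<lambda>x. legendre n x * legendre m x))) {-1..1}"
    by (intro has_integral_sum has_integral_mult_right integrable_integral integrable_legendre_mult
          continuous_intros) auto
  also have "(\<Sum>n<q. coeff n * integral {-1..1} (\<lambda>x. legendre n x * legendre m x))
     = (\<Sum>n<q. if n = m then coeff n * (2 / real (2 * n + 1)) else 0)"
    by (intro sum.cong) (auto simp: legendre_orthogonal legendre_norm)
  also have "\<dots> = (if m < q then coeff m * (2 / real (2 * m + 1)) else 0)" by simp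
  also have "coeff m * (2 / real (2 * m + 1)) = integral {-1..1} (\<lambda>x. f x * legendre m x)"
    by (simp add: coeff_def field_simps)
  finally show ?thesis by (simp add: partial_sum_def sum_distrib_right mult.assoc)
qed

lemma abs_partial_sum_diff_le:
  assumes "0 < q" "q \<le> N" "x \<in> {-1..1}"
  shows "\<bar>partial_sum N x - partial_sum q x\<bar> \<le> K / real q ^ (\<nu> - 1)"
proof -
  have "partial_sum N x - partial_sum q x = (\<Sum>n\<in>{q..<N}. coeff n * legendre n x)"
    using assms(2) sum_diff_nat_ivl[of 0 q N "\<lambda>n. coeff n * legendre n x"]
    by (simp add: partial_sum_def atLeast0LessThan)
  also have "\<bar>\<dots>\<bar> \<le> (\<Sum>n\<in>{q..<N}. \<bar>coeff n * legendre n x\<bar>)" by (rule sum_abs)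
  also have "\<dots> \<le> (\<Sum>n\<in>{q..<N}. K * (1 / real (n + 1) ^ \<nu>))"
  proof (rule sum_mono)
    fix n
    have "\<bar>coeff n * legendre n x\<bar> \<le> \<bar>coeff n\<bar> * 1"
      unfolding abs_mult by (intro mult_left_mono abs_legendre_le_1 assms) auto
    with abs_coeff_le[of n] show "\<bar>coeff n * legendre n x\<bar> \<le> K * (1 / real (n + 1) ^ \<nu>)" by simp
  qed
  also have "\<dots> = K * (\<Sum>n\<in>{q..<N}. 1 / real (n + 1) ^ \<nu>)" by (simp add: sum_distrib_left)
  also have "\<dots> \<le> K * (1 / real q ^ (\<nu> - 1))"
    using K_nonneg \<nu> assms by (intro mult_left_mono sum_inverse_powers_le) auto
  finally show ?thesis by simp
qed

text \<open>The series converges uniformly by the M-test, since \<nu> is at least 2. Its continuous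
  limit \<open>g\<close> has the same Legendre integrals as \<open>f\<close>, so completeness forces
  \<open>f = g\<close> on the interval.\<close>

lemma partial_sum_tendsto:
  assumes "x \<in> {-1..1}"
  shows "(\<lambda>N. partial_sum N x) \<longlonglongrightarrow> f x"
proof -
  define g where "g x = (\<Sum>n. coeff n * legendre n x)" for x
  have "summable (\<lambda>n. K * (1 / real (n + 1) ^ 2))"
    using inverse_squares_sums by (intro summable_mult) (simp add: sums_iff add.commute)
  moreover have "norm (coeff n * legendre n x) \<le> K * (1 / real (n + 1) ^ 2)" if "x \<in> {-1..1}" for n x
  proof -
    have "\<bar>coeff n * legendre n x\<bar> \<le> \<bar>coeff n\<bar> * 1"
      unfolding abs_mult by (intro mult_left_mono abs_legendre_le_1 that) auto
    also have "\<dots> \<le> K / real (n + 1) ^ \<nu>" using abs_coeff_le[of n] by simp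
    also have "\<dots> \<le> K / real (n + 1) ^ 2"
      using K_nonneg \<nu> by (intro divide_left_mono power_increasing) auto
    finally show ?thesis by simp
  qed
  ultimately have lim: "uniform_limit {-1..1} partial_sum g sequentially"
    unfolding g_def partial_sum_def[abs_def] by (intro Weierstrass_m_test)
  have g: "continuous_on {-1..1} g"
    by (rule uniform_limit_theorem[OF _ lim]) (auto intro!: always_eventually continuous_intros)
  have "f x - g x = 0"
  proof (rule orthogonal_to_legendre_imp_zero[OF _ _ assms])
    show "continuous_on {-1..1} (\<lambda>x. f x - g x)" by (intro continuous_intros cont g)
    fix m
    have int: "continuous_on {-1..1} F \<Longrightarrow> (\<lambda>x. F x * legendre m x) integrable_on {-1..1}" for F
      by (rule integrable_legendre_mult)
    let ?c = "integral {-1..1} (\<lambda>x. f x * legendre m x)"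
    have "uniform_limit {-1..1} (\<lambda>N x. partial_sum N x * legendre m x) (\<lambda>x. g x * legendre m x) sequentially"
    proof (rule uniform_limitI)
      fix e :: real assume "e > 0"
      from uniform_limitD[OF lim this]
      show "\<forall>\<^sub>F N in sequentially. \<forall>x\<in>{-1..1}. dist (partial_sum N x * legendre m x) (g x * legendre m x) < e"
      proof eventually_elim
        case (elim N)
        show ?case
        proof
          fix x :: real assume x: "x \<in> {-1..1}"
          have "dist (partial_sum N x * legendre m x) (g x * legendre m x)
              = \<bar>partial_sum N x - g x\<bar> * \<bar>legendre m x\<bar>"
            by (simp add: dist_real_def flip: abs_mult left_diff_distrib)
          also have "\<dots> \<le> \<bar>partial_sum N x - g x\<bar> * 1"
            by (intro mult_left_mono abs_legendre_le_1 x) auto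
          also have "\<dots> < e" using elim x by (auto simp: dist_real_def)
          finally show "dist (partial_sum N x * legendre m x) (g x * legendre m x) < e" .
        qed
      qed
    qed
    then obtain I J where
      I: "\<And>N. ((\<lambda>x. partial_sum N x * legendre m x) has_integral I N) {-1..1}"
      and J: "((\<lambda>x. g x * legendre m x) has_integral J) {-1..1}" and IJ: "I \<longlonglongrightarrow> J"
      by (rule uniform_limit_integral) (auto intro!: continuous_intros)
    have "I N = ?c" if "m < N" for N
      using has_integral_unique[OF I integral_partial_sum_mult[of N m]] that by simp
    then have "I \<longlonglongrightarrow> ?c"
      by (intro tendsto_eventually eventually_mono[OF eventually_gt_at_top[of m]])
    with IJ have "J = ?c" using LIMSEQ_unique by blast
    with J have "((\<lambda>x. f x * legendre m x - g x * legendre m x) has_integral ?c - ?c) {-1..1}"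
      by (intro has_integral_diff integrable_integral int cont) simp_all
    then show "integral {-1..1} (\<lambda>x. (f x - g x) * legendre m x) = 0"
      by (intro integral_unique) (simp add: left_diff_distrib)
  qed
  with tendsto_uniform_limitI[OF lim assms] show ?thesis by simp
qed

lemma abs_diff_partial_sum_le:
  assumes "0 < q" "x \<in> {-1..1}"
  shows "\<bar>f x - partial_sum q x\<bar> \<le> K / real q ^ (\<nu> - 1)"
proof (rule LIMSEQ_le_const2)
  show "(\<lambda>N. \<bar>partial_sum N x - partial_sum q x\<bar>) \<longlonglongrightarrow> \<bar>f x - partial_sum q x\<bar>"
    by (intro tendsto_intros partial_sum_tendsto assms)
  show "\<exists>N. \<forall>n\<ge>N. \<bar>partial_sum n x - partial_sum q x\<bar> \<le> K / real q ^ (\<nu> - 1)"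
    using abs_partial_sum_diff_le assms by blast
qed

text \<open>Bessel's identity. It is applied to two truncation orders at once, so that their errors
  differ by a finite sum and no series has to be integrated.\<close>

lemma integral_diff_partial_sum_square:
  "integral {-1..1} (\<lambda>x. (f x - partial_sum q x)\<^sup>2)
     = integral {-1..1} (\<lambda>x. (f x)\<^sup>2) - (\<Sum>n<q. (coeff n)\<^sup>2 * (2 / real (2 * n + 1)))"
proof (induction q)
  case 0
  then show ?case by (simp add: partial_sum_def)
next
  case (Suc q)
  let ?c = "integral {-1..1} (\<lambda>x. f x * legendre q x)"
  have eq: "(f x - partial_sum (Suc q) x)\<^sup>2 = (f x - partial_sum q x)\<^sup>2
      - 2 * coeff q * (f x * legendre q x - partial_sum q x * legendre q x)
      + (coeff q)\<^sup>2 * (legendre q x * legendre q x)" for x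
    unfolding partial_sum_def by (simp add: power2_eq_square algebra_simps)
  have P: "((\<lambda>x. partial_sum q x * legendre q x) has_integral 0) {-1..1}"
    using integral_partial_sum_mult[of q q] by simp
  have L: "((\<lambda>x. legendre q x * legendre q x) has_integral 2 / real (2 * q + 1)) {-1..1}"
    using integrable_integral[OF integrable_legendre_mult[of "legendre q" q]]
    by (simp add: legendre_norm continuous_intros)
  have "((\<lambda>x. (f x - partial_sum (Suc q) x)\<^sup>2) has_integral
     integral {-1..1} (\<lambda>x. (f x - partial_sum q x)\<^sup>2) - 2 * coeff q * (?c - 0)
      + (coeff q)\<^sup>2 * (2 / real (2 * q + 1))) {-1..1}"
    unfolding eq
    by (intro has_integral_add has_integral_diff has_integral_mult_right P L integrable_integral
          integrable_legendre_mult cont integrable_continuous_real continuous_intros)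
  moreover have "?c = coeff q * (2 / real (2 * q + 1))" by (simp add: coeff_def field_simps)
  ultimately show ?case
    using Suc by (auto dest!: integral_unique simp: power2_eq_square algebra_simps)
qed

text \<open>Integrating the squared uniform bound would lose two powers of \<open>q\<close>. Instead
  the error at \<open>q\<close> is the error at a large \<open>N\<close>, which tends to 0, plus the
  Bessel terms between; each of these gains an extra \<open>1 / (n + 1)\<close> from the norm of the
  polynomial.\<close>

lemma integral_diff_partial_sum_square_le:
  assumes q: "0 < q"
  shows "integral {-1..1} (\<lambda>x. (f x - partial_sum q x)\<^sup>2) \<le> 2 * K\<^sup>2 / real q ^ (2 * \<nu>)"
proof (rule LIMSEQ_le_const)
  show "(\<lambda>N. 2 * K\<^sup>2 * (1 / real N) + 2 * K\<^sup>2 / real q ^ (2 * \<nu>)) \<longlonglongrightarrow> 2 * K\<^sup>2 / real q ^ (2 * \<nu>)"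
    by (rule tendsto_eq_intros lim_1_over_n refl | simp)+
  let ?I = "\<lambda>q. integral {-1..1} (\<lambda>x. (f x - partial_sum q x)\<^sup>2)"
  have "?I q \<le> 2 * K\<^sup>2 * (1 / real N) + 2 * K\<^sup>2 / real q ^ (2 * \<nu>)" if N: "N \<ge> q" for N
  proof -
    \<comment> \<open>Any bound tending to 0 is enough here, so the uniform error is weakened to
      \<open>K / N\<close> before squaring.\<close>
    have "?I N \<le> integral {-1..1} (\<lambda>x::real. K\<^sup>2 * (1 / real N))"
    proof (rule Henstock_Kurzweil_Integration.integral_le)
      show "(\<lambda>x. (f x - partial_sum N x)\<^sup>2) integrable_on {-1..1}"
        by (intro integrable_continuous_real continuous_intros cont)
      fix x :: real assume x: "x \<in> {-1..1}"
      have "\<bar>f x - partial_sum N x\<bar> \<le> K / real N ^ (\<nu> - 1)"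
        using q N x by (intro abs_diff_partial_sum_le) auto
      also have "\<dots> \<le> K / real N ^ 1"
        using q N \<nu> K_nonneg by (intro divide_left_mono power_increasing) auto
      finally have "\<bar>f x - partial_sum N x\<bar>\<^sup>2 \<le> (K / real N)\<^sup>2" by (intro power_mono) auto
      also have "\<dots> = K\<^sup>2 / (real N * real N)" by (simp add: power_divide power2_eq_square)
      also have "\<dots> \<le> K\<^sup>2 / (1 * real N)"
        using q N by (intro divide_left_mono mult_right_mono) auto
      finally show "(f x - partial_sum N x)\<^sup>2 \<le> K\<^sup>2 * (1 / real N)" by simp
    qed (rule integrable_const_ivl)
    then have 1: "?I N \<le> 2 * K\<^sup>2 * (1 / real N)" by simp
    have "?I q = ?I N + (\<Sum>n\<in>{q..<N}. (coeff n)\<^sup>2 * (2 / real (2 * n + 1)))"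
      using N sum_diff_nat_ivl[of 0 q N "\<lambda>n. (coeff n)\<^sup>2 * (2 / real (2 * n + 1))"]
      by (simp add: integral_diff_partial_sum_square atLeast0LessThan)
    also have "(\<Sum>n\<in>{q..<N}. (coeff n)\<^sup>2 * (2 / real (2 * n + 1)))
        \<le> (\<Sum>n\<in>{q..<N}. 2 * K\<^sup>2 * (1 / real (n + 1) ^ (2 * \<nu> + 1)))"
    proof (rule sum_mono)
      fix n
      have "\<bar>coeff n\<bar>\<^sup>2 * (2 / real (2 * n + 1)) \<le> (K / real (n + 1) ^ \<nu>)\<^sup>2 * (2 / real (n + 1))"
        using abs_coeff_le by (intro mult_mono power_mono divide_left_mono) auto
      also have "\<dots> = 2 * K\<^sup>2 * (1 / real (n + 1) ^ (2 * \<nu> + 1))"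
        by (simp add: power_divide power_mult[symmetric] mult.commute)
      finally show "(coeff n)\<^sup>2 * (2 / real (2 * n + 1)) \<le> 2 * K\<^sup>2 * (1 / real (n + 1) ^ (2 * \<nu> + 1))"
        by simp
    qed
    also have "\<dots> = 2 * K\<^sup>2 * (\<Sum>n\<in>{q..<N}. 1 / real (n + 1) ^ (2 * \<nu> + 1))"
      by (simp add: sum_distrib_left)
    also have "\<dots> \<le> 2 * K\<^sup>2 * (1 / real q ^ (2 * \<nu> + 1 - 1))"
      using \<nu> q by (intro mult_left_mono sum_inverse_powers_le) auto
    finally show ?thesis using 1 by simp
  qed
  then show "\<exists>M. \<forall>N\<ge>M. ?I q \<le> 2 * K\<^sup>2 * (1 / real N) + 2 * K\<^sup>2 / real q ^ (2 * \<nu>)" by blast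
qed

end

lemma derivatives_bv_continuous_on:
  assumes "derivatives_bv \<nu> V f" "0 < \<nu>"
  shows "continuous_on {-1..1} f"
proof -
  obtain D where D0: "\<And>x. x \<in> {-1..1} \<Longrightarrow> D 0 x = f x"
    and D: "\<And>j x. \<lbrakk>j < \<nu>; x \<in> {-1..1}\<rbrakk> \<Longrightarrow> (D j has_real_derivative D (Suc j) x) (at x within {-1..1})"
    using assms(1) unfolding derivatives_bv_def by blast
  from D[OF assms(2)] have "continuous_on {-1..1} (D 0)" by (rule DERIV_continuous_on)
  then show ?thesis by (rule continuous_on_eq) (rule D0)
qed

text \<open>A single coefficient sequence serves every \<open>q\<close>, with one constant for both
  kinds of error.\<close>

lemma legendre_approximation:
  assumes "derivatives_bv \<nu> V f" "2 \<le> \<nu>"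
  shows "\<exists>K a. K \<ge> 0 \<and> (\<forall>n. \<bar>a n\<bar> \<le> K) \<and>
    (\<forall>q>0. (\<forall>x\<in>{-1..1}. \<bar>f x - (\<Sum>n<q. a n * legendre n x)\<bar> \<le> K / real q ^ (\<nu> - 1)) \<and>
      integral {-1..1} (\<lambda>x. (f x - (\<Sum>n<q. a n * legendre n x))\<^sup>2) \<le> 2 * K\<^sup>2 / real q ^ (2 * \<nu>))"
proof -
  from legendre_coefficient_decay[OF assms(1)] obtain K where
    K: "\<And>n. \<bar>integral {-1..1} (\<lambda>x. f x * legendre n x)\<bar> \<le> K / real (n + 1) ^ (\<nu> + 1)" by blast
  interpret legendre_series f K \<nu>
    using assms(2) K derivatives_bv_continuous_on[OF assms(1)] by unfold_locales auto
  show ?thesis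
    using K_nonneg abs_coeff_le_K abs_diff_partial_sum_le integral_diff_partial_sum_square_le
    unfolding partial_sum_def by (intro exI[of _ K] exI[of _ coeff]) auto
qed

section \<open>One step of gradient descent\<close>

lemma strongly_convex_smoothD:
  assumes "strongly_convex_smooth \<mu> L f"
  shows "\<mu> / 2 * (norm (x - y))\<^sup>2 \<le> f x - f y - gradient f y \<bullet> (x - y)"
    and "f x - f y - gradient f y \<bullet> (x - y) \<le> L / 2 * (norm (x - y))\<^sup>2"
    and "continuous_on S f"
  using assms unfolding strongly_convex_smooth_def
  by (auto intro!: continuous_at_imp_continuous_on differentiable_imp_continuous_within)

text \<open>A gradient step of length \<open>1 / L\<close> lowers \<open>f\<close> by at least the
  squared gradient norm over \<open>2 * L\<close>, and cannot get below \<open>m\<close>.\<close>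

lemma norm_gradient_square_le:
  assumes f: "strongly_convex_smooth \<mu> L f" and L: "0 < L" and m: "\<And>y. m \<le> f y"
  shows "(norm (gradient f x))\<^sup>2 \<le> 2 * L * (f x - m)"
proof -
  let ?g = "gradient f x"
  have "f (x - (1 / L) *\<^sub>R ?g) - f x - ?g \<bullet> (x - (1 / L) *\<^sub>R ?g - x)
      \<le> L / 2 * (norm (x - (1 / L) *\<^sub>R ?g - x))\<^sup>2"
    by (rule strongly_convex_smoothD(2)[OF f])
  also have "L / 2 * (norm (x - (1 / L) *\<^sub>R ?g - x))\<^sup>2 = (norm ?g)\<^sup>2 / (2 * L)"
    using L by (simp add: power_mult_distrib field_simps power2_eq_square)
  also have "?g \<bullet> (x - (1 / L) *\<^sub>R ?g - x) = - ((norm ?g)\<^sup>2 / L)"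
    by (simp add: power2_norm_eq_inner)
  finally have "f (x - (1 / L) *\<^sub>R ?g) - f x + (norm ?g)\<^sup>2 / L \<le> (norm ?g)\<^sup>2 / (2 * L)" by simp
  moreover have "(norm ?g)\<^sup>2 / L = (norm ?g)\<^sup>2 / (2 * L) + (norm ?g)\<^sup>2 / (2 * L)" by simp
  ultimately have "f (x - (1 / L) *\<^sub>R ?g) \<le> f x - (norm ?g)\<^sup>2 / (2 * L)" by linarith
  with m[of "x - (1 / L) *\<^sub>R ?g"] have "(norm ?g)\<^sup>2 / (2 * L) \<le> f x - m" by linarith
  then show ?thesis using L by (simp add: field_simps)
qed

text \<open>The gradient at a minimiser is zero by the preceding bound with \<open>m = f z\<close>,
  so the smoothness inequality at \<open>z\<close> has no linear term.\<close>

lemma gap_le_norm_square: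
  assumes f: "strongly_convex_smooth \<mu> L f" and L: "0 < L" and m: "\<And>y. f z \<le> f y"
  shows "f x - f z \<le> L / 2 * (norm (x - z))\<^sup>2"
proof -
  have "gradient f z = 0" using norm_gradient_square_le[OF f L m, of z] by simp
  then show ?thesis using strongly_convex_smoothD(2)[OF f, of x z] by simp
qed

text \<open>Serves measurability: \<open>gradient\<close> is a \<open>THE\<close> term, and this
  writes its components as pointwise limits of values of \<open>f\<close>. Convexity and smoothness
  squeeze the error of the quotient between 0 and a multiple of the increment.\<close>

lemma difference_quotient_tendsto_gradient:
  assumes f: "strongly_convex_smooth \<mu> L f" and \<mu>: "0 \<le> \<mu>"
  shows "(\<lambda>k. real (Suc k) * (f (x + (1 / real (Suc k)) *\<^sub>R e) - f x)) \<longlonglongrightarrow> gradient f x \<bullet> e"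
proof (rule Lim_transform_eventually)
  let ?q = "\<lambda>k. real (Suc k) * (f (x + (1 / real (Suc k)) *\<^sub>R e) - f x)"
  have "(\<lambda>k. L / 2 * (norm e)\<^sup>2 * (1 / real (Suc k))) \<longlonglongrightarrow> L / 2 * (norm e)\<^sup>2 * 0"
    by (intro tendsto_mult tendsto_const LIMSEQ_Suc[OF lim_1_over_n])
  then have "(\<lambda>k. ?q k - gradient f x \<bullet> e) \<longlonglongrightarrow> 0"
  proof (rule Lim_null_comparison[rotated, OF tendsto_eq_rhs])
    show "\<forall>\<^sub>F k in sequentially. norm (?q k - gradient f x \<bullet> e) \<le> L / 2 * (norm e)\<^sup>2 * (1 / real (Suc k))"
    proof (rule always_eventually, rule allI)
      fix k
      define r where "r = real (Suc k)"
      have r: "r > 0" by (simp add: r_def)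
      define d where "d = f (x + (1 / r) *\<^sub>R e) - f x - gradient f x \<bullet> ((1 / r) *\<^sub>R e)"
      have "\<mu> / 2 * (norm ((1 / r) *\<^sub>R e))\<^sup>2 \<le> d" "d \<le> L / 2 * (norm ((1 / r) *\<^sub>R e))\<^sup>2"
        using strongly_convex_smoothD(1,2)[OF f, of "x + (1 / r) *\<^sub>R e" x] by (simp_all add: d_def)
      moreover have "0 \<le> \<mu> / 2 * (norm ((1 / r) *\<^sub>R e))\<^sup>2" using \<mu> by simp
      ultimately have "0 \<le> d" "d \<le> L / 2 * (norm e)\<^sup>2 / r\<^sup>2"
        by (auto simp: power_divide)
      then have "0 \<le> r * d" "r * d \<le> r * (L / 2 * (norm e)\<^sup>2 / r\<^sup>2)"
        using r by (auto intro: mult_left_mono simp del: times_divide_eq_right)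
      moreover have "r * (L / 2 * (norm e)\<^sup>2 / r\<^sup>2) = L / 2 * (norm e)\<^sup>2 * (1 / r)"
        using r by (simp add: power2_eq_square)
      moreover have "r * (f (x + (1 / r) *\<^sub>R e) - f x) - gradient f x \<bullet> e = r * d"
        using r by (simp add: d_def right_diff_distrib)
      ultimately show "norm (?q k - gradient f x \<bullet> e) \<le> L / 2 * (norm e)\<^sup>2 * (1 / real (Suc k))"
        unfolding r_def[symmetric] by simp
    qed
  qed simp
  then show "?q \<longlonglongrightarrow> gradient f x \<bullet> e" by (rule LIM_zero_cancel)
qed simp

section \<open>The matrix of Legendre values and its transpose\<close>

lemma Phi_mult_nth: "Phi_mult q l \<beta> $ i = (\<Sum>n<q. legendre n l * \<beta> (i, n))"
proof -
  have "Phi_mult q l \<beta> $ i = (\<Sum>j\<in>UNIV. \<Sum>n<q. Phi l i (j, n) * \<beta> (j, n))"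
    by (simp add: Phi_mult_def coeff_index_def sum.cartesian_product)
  also have "\<dots> = (\<Sum>j\<in>UNIV. if j = i then \<Sum>n<q. legendre n l * \<beta> (j, n) else 0)"
    by (intro sum.cong) (auto simp: Phi_def)
  finally show ?thesis by simp
qed

lemma Phi_mult_diff: "Phi_mult q l \<beta> - Phi_mult q l b = Phi_mult q l (\<lambda>c. \<beta> c - b c)"
  by (simp add: vec_eq_iff Phi_mult_nth right_diff_distrib sum_subtractf)

lemma Phi_transpose_mult_nth: "Phi_transpose_mult l g (i, n) = legendre n l * g $ i"
proof -
  have "Phi_transpose_mult l g (i, n) = (\<Sum>j\<in>UNIV. if j = i then legendre n l * g $ j else 0)"
    unfolding Phi_transpose_mult_def by (intro sum.cong) (auto simp: Phi_def)
  then show ?thesis by simp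
qed

lemma sum_coeff_index: "(\<Sum>c\<in>coeff_index q. F c) = (\<Sum>i\<in>UNIV. \<Sum>n<q. F (i, n))"
  by (simp add: coeff_index_def sum.cartesian_product)

lemma Phi_adjoint:
  "(\<Sum>c\<in>coeff_index q. Phi_transpose_mult l g c * \<beta> c) = g \<bullet> Phi_mult q l \<beta>"
  by (simp add: sum_coeff_index Phi_transpose_mult_nth Phi_mult_nth inner_vec_def sum_distrib_left mult_ac)

lemma norm_vec_square: "(norm (x :: real ^ 'd))\<^sup>2 = (\<Sum>i\<in>UNIV. (x $ i)\<^sup>2)"
  by (simp add: norm_vec_def L2_set_def sum_nonneg)

lemma sum_Phi_transpose_mult_square_le:
  assumes "l \<in> {-1..1}"
  shows "(\<Sum>c\<in>coeff_index q. (Phi_transpose_mult l g c)\<^sup>2) \<le> real q * (norm g)\<^sup>2"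
proof -
  have "(\<Sum>c\<in>coeff_index q. (Phi_transpose_mult l g c)\<^sup>2) = (\<Sum>n<q. (legendre n l)\<^sup>2) * (norm g)\<^sup>2"
    by (simp add: sum_coeff_index Phi_transpose_mult_nth norm_vec_square power_mult_distrib
          sum_product sum.swap[of _ UNIV])
  also have "\<dots> \<le> real q * (norm g)\<^sup>2"
    by (intro mult_right_mono sum_legendre_squares_le assms) auto
  finally show ?thesis .
qed

lemma norm_Phi_mult_square_le:
  assumes "l \<in> {-1..1}"
  shows "(norm (Phi_mult q l \<beta>))\<^sup>2 \<le> real q * (\<Sum>c\<in>coeff_index q. (\<beta> c)\<^sup>2)"
proof -
  have "(norm (Phi_mult q l \<beta>))\<^sup>2 = (\<Sum>i\<in>UNIV. (\<Sum>n<q. legendre n l * \<beta> (i, n))\<^sup>2)"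
    by (simp add: norm_vec_square Phi_mult_nth)
  also have "\<dots> \<le> (\<Sum>i\<in>UNIV. real q * (\<Sum>n<q. (\<beta> (i, n))\<^sup>2))"
  proof (rule sum_mono)
    fix i
    have "(\<Sum>n<q. legendre n l * \<beta> (i, n))\<^sup>2 \<le> (\<Sum>n<q. (legendre n l)\<^sup>2) * (\<Sum>n<q. (\<beta> (i, n))\<^sup>2)"
      by (rule Cauchy_Schwarz_ineq_sum)
    also have "\<dots> \<le> real q * (\<Sum>n<q. (\<beta> (i, n))\<^sup>2)"
      by (intro mult_right_mono sum_legendre_squares_le assms sum_nonneg) auto
    finally show "(\<Sum>n<q. legendre n l * \<beta> (i, n))\<^sup>2 \<le> real q * (\<Sum>n<q. (\<beta> (i, n))\<^sup>2)" .
  qed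
  also have "\<dots> = real q * (\<Sum>c\<in>coeff_index q. (\<beta> c)\<^sup>2)"
    by (simp add: sum_coeff_index sum_distrib_left)
  finally show ?thesis .
qed

text \<open>For simple functions in place of \<open>Y\<close> only countably many sections of
  \<open>f\<close> occur; continuity in the second argument passes to the limit.\<close>

lemma borel_measurable_caratheodory:
  fixes f :: "'a \<Rightarrow> 'b::{second_countable_topology, metric_space} \<Rightarrow> real"
  assumes cont: "\<And>w. w \<in> space M \<Longrightarrow> continuous_on UNIV (f w)"
    and meas: "\<And>x. (\<lambda>w. f w x) \<in> borel_measurable M"
    and Y: "Y \<in> borel_measurable M"
  shows "(\<lambda>w. f w (Y w)) \<in> borel_measurable M"
proof -
  obtain F where F: "\<And>i. simple_function M (F i)"
    and lim: "\<And>w. w \<in> space M \<Longrightarrow> (\<lambda>i. F i w) \<longlonglongrightarrow> Y w"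
    using borel_measurable_implies_sequence_metric[OF Y] by blast
  show ?thesis
  proof (rule borel_measurable_LIMSEQ_real)
    fix w assume w: "w \<in> space M"
    show "(\<lambda>i. f w (F i w)) \<longlonglongrightarrow> f w (Y w)"
      by (rule continuous_on_tendsto_compose[OF cont[OF w] lim[OF w]]) auto
  next
    fix i
    show "(\<lambda>w. f w (F i w)) \<in> borel_measurable M"
    proof (rule measurable_compose_countable'[where f = "\<lambda>x w. f w x" and I = "F i ` space M"])
      show c: "countable (F i ` space M)"
        using F[of i] by (auto simp: simple_function_def countable_finite)
      show "F i \<in> measurable M (count_space (F i ` space M))"
        using F[of i] c by (auto simp: measurable_count_space_eq_countable simple_function_def)
    qed (rule meas)
  qed
qed

locale solution_path =
  fixes h :: "real ^ 'd::finite \<Rightarrow> real \<Rightarrow> real"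
    and \<theta>s :: "real \<Rightarrow> real ^ 'd"
    and \<mu> L :: real
  assumes \<mu>_pos: "0 < \<mu>" and \<mu>_le_L: "\<mu> \<le> L"
    and h_convex: "\<And>l. l \<in> {-1..1} \<Longrightarrow> strongly_convex_smooth \<mu> L (\<lambda>\<theta>. h \<theta> l)"
    and h_measurable: "\<And>\<theta>. h \<theta> \<in> borel_measurable (restrict_space borel {-1..1})"
    and \<theta>s_min: "\<And>l. l \<in> {-1..1} \<Longrightarrow> is_arg_min (\<lambda>\<theta>. h \<theta> l) (\<lambda>_. True) (\<theta>s l)"
begin

lemma L_pos: "0 < L" using \<mu>_pos \<mu>_le_L by simp

lemma h_min: "l \<in> {-1..1} \<Longrightarrow> h (\<theta>s l) l \<le> h \<theta> l"
  using \<theta>s_min[of l] by (auto simp: is_arg_min_def not_less)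

lemma gap_le: "l \<in> {-1..1} \<Longrightarrow> h \<theta> l - h (\<theta>s l) l \<le> L / 2 * (norm (\<theta> - \<theta>s l))\<^sup>2"
  by (rule gap_le_norm_square[OF h_convex L_pos h_min])

text \<open>The step size absorbs the second-order term: \<open>\<parallel>\<nabla>h\<parallel>\<^sup>2 \<le> 2 L (h - min h)\<close> lets it be charged to the
  decrease of the objective, so that only the suboptimality of the reference point \<open>b\<close> remains.\<close>

lemma sgd_step:
  fixes \<beta> b :: "'d \<times> nat \<Rightarrow> real"
  assumes l: "l \<in> {-1..1}" and \<eta>: "0 < \<eta>" "\<eta> * (real q * L) \<le> 1"
  defines "g \<equiv> gradient (\<lambda>\<theta>. h \<theta> l) (Phi_mult q l \<beta>)"
  shows "(\<Sum>c\<in>coeff_index q. (\<beta> c - \<eta> * Phi_transpose_mult l g c - b c)\<^sup>2)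
    \<le> (\<Sum>c\<in>coeff_index q. (\<beta> c - b c)\<^sup>2)
      - \<eta> * \<mu> * (norm (Phi_mult q l (\<lambda>c. \<beta> c - b c)))\<^sup>2
      + \<eta> * L * (norm (Phi_mult q l b - \<theta>s l))\<^sup>2"
proof -
  let ?v = "\<lambda>c. \<beta> c - b c" and ?f = "\<lambda>\<theta>. h \<theta> l"
  let ?x = "Phi_mult q l \<beta>" and ?y = "Phi_mult q l b"
  let ?P = "Phi_transpose_mult l g"
  have "(\<Sum>c\<in>coeff_index q. (\<beta> c - \<eta> * ?P c - b c)\<^sup>2)
      = (\<Sum>c\<in>coeff_index q. (?v c)\<^sup>2) - 2 * \<eta> * (\<Sum>c\<in>coeff_index q. ?P c * ?v c)
        + \<eta>\<^sup>2 * (\<Sum>c\<in>coeff_index q. (?P c)\<^sup>2)"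
    unfolding sum_distrib_left sum_subtractf[symmetric] sum.distrib[symmetric]
    by (intro sum.cong) (auto simp: power2_eq_square algebra_simps)
  also have "\<dots> = (\<Sum>c\<in>coeff_index q. (?v c)\<^sup>2) - 2 * \<eta> * (g \<bullet> (?x - ?y))
        + \<eta>\<^sup>2 * (\<Sum>c\<in>coeff_index q. (?P c)\<^sup>2)"
    by (simp add: Phi_adjoint Phi_mult_diff)
  finally have 1: "(\<Sum>c\<in>coeff_index q. (\<beta> c - \<eta> * ?P c - b c)\<^sup>2) = \<dots>" .
  have "(\<Sum>c\<in>coeff_index q. (?P c)\<^sup>2) \<le> real q * (norm g)\<^sup>2"
    by (rule sum_Phi_transpose_mult_square_le[OF l])
  also have "\<dots> \<le> real q * (2 * L * (?f ?x - ?f (\<theta>s l)))"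
    unfolding g_def
    by (intro mult_left_mono norm_gradient_square_le[OF h_convex[OF l] L_pos h_min[OF l]]) auto
  finally have "\<eta>\<^sup>2 * (\<Sum>c\<in>coeff_index q. (?P c)\<^sup>2) \<le> \<eta>\<^sup>2 * (real q * (2 * L * (?f ?x - ?f (\<theta>s l))))"
    by (intro mult_left_mono) auto
  also have "\<dots> = 2 * \<eta> * ((\<eta> * (real q * L)) * (?f ?x - ?f (\<theta>s l)))"
    by (simp add: power2_eq_square)
  also have "\<dots> \<le> 2 * \<eta> * (1 * (?f ?x - ?f (\<theta>s l)))"
    using \<eta> h_min[OF l, of ?x] by (intro mult_left_mono mult_right_mono) auto
  finally have 2: "\<eta>\<^sup>2 * (\<Sum>c\<in>coeff_index q. (?P c)\<^sup>2) \<le> 2 * \<eta> * (?f ?x - ?f (\<theta>s l))" by simp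
  \<comment> \<open>Strong convexity is used at the iterate, towards the reference point. The gap at
    \<open>?x\<close> then cancels against the one in fact \<open>2\<close>.\<close>
  have "\<mu> / 2 * (norm (?x - ?y))\<^sup>2 + ?f ?x - g \<bullet> (?x - ?y) \<le> ?f ?y"
    using strongly_convex_smoothD(1)[OF h_convex[OF l], of ?y ?x]
    by (simp add: g_def norm_minus_commute inner_diff_right)
  moreover have "?f ?y - ?f (\<theta>s l) \<le> L / 2 * (norm (?y - \<theta>s l))\<^sup>2" by (rule gap_le[OF l])
  ultimately have "?f ?x - ?f (\<theta>s l) - g \<bullet> (?x - ?y)
      \<le> L / 2 * (norm (?y - \<theta>s l))\<^sup>2 - \<mu> / 2 * (norm (?x - ?y))\<^sup>2" by linarith
  then have "2 * \<eta> * (?f ?x - ?f (\<theta>s l) - g \<bullet> (?x - ?y))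
      \<le> 2 * \<eta> * (L / 2 * (norm (?y - \<theta>s l))\<^sup>2 - \<mu> / 2 * (norm (?x - ?y))\<^sup>2)"
    using \<eta> by (intro mult_left_mono) auto
  also have "\<dots> = \<eta> * L * (norm (?y - \<theta>s l))\<^sup>2 - \<eta> * \<mu> * (norm (?x - ?y))\<^sup>2"
    by (simp add: algebra_simps)
  finally show ?thesis
    using 1 2 by (simp add: right_diff_distrib Phi_mult_diff)
qed

lemma gap_le_distances:
  assumes l: "l \<in> {-1..1}"
  shows "h (Phi_mult q l \<beta>) l - h (\<theta>s l) l
    \<le> L * (real q * (\<Sum>c\<in>coeff_index q. (\<beta> c - b c)\<^sup>2) + (norm (Phi_mult q l b - \<theta>s l))\<^sup>2)"
proof -
  let ?x = "Phi_mult q l \<beta>" and ?y = "Phi_mult q l b"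
  have "norm (?x - \<theta>s l) \<le> norm (?x - ?y) + norm (?y - \<theta>s l)"
    using norm_triangle_ineq[of "?x - ?y" "?y - \<theta>s l"] by simp
  then have "(norm (?x - \<theta>s l))\<^sup>2 \<le> (norm (?x - ?y) + norm (?y - \<theta>s l))\<^sup>2" by (intro power_mono) auto
  also have "\<dots> \<le> 2 * ((norm (?x - ?y))\<^sup>2 + (norm (?y - \<theta>s l))\<^sup>2)"
    using sum_squares_bound[of "norm (?x - ?y)" "norm (?y - \<theta>s l)"] by (simp add: power2_sum)
  also have "(norm (?x - ?y))\<^sup>2 \<le> real q * (\<Sum>c\<in>coeff_index q. (\<beta> c - b c)\<^sup>2)"
    unfolding Phi_mult_diff by (rule norm_Phi_mult_square_le[OF l])
  finally have "L / 2 * (norm (?x - \<theta>s l))\<^sup>2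
      \<le> L / 2 * (2 * (real q * (\<Sum>c\<in>coeff_index q. (\<beta> c - b c)\<^sup>2) + (norm (?y - \<theta>s l))\<^sup>2))"
    using L_pos by (intro mult_left_mono) auto
  also have "\<dots> = L * (real q * (\<Sum>c\<in>coeff_index q. (\<beta> c - b c)\<^sup>2) + (norm (?y - \<theta>s l))\<^sup>2)"
    by simp
  finally show ?thesis using gap_le[OF l, of ?x] by (rule order_trans[rotated])
qed

text \<open>The difference quotients along the axes are Caratheodory compositions of
  \<open>h\<close>. \<open>Y\<close> must stay in \<open>{-1..1}\<close> because \<open>h\<close> is
  controlled only there.\<close>

lemma gradient_nth_measurable:
  assumes Y: "Y \<in> borel_measurable N" "\<And>w. w \<in> space N \<Longrightarrow> Y w \<in> {-1..1}"
    and B: "B \<in> borel_measurable N"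
  shows "(\<lambda>w. gradient (\<lambda>\<theta>. h \<theta> (Y w)) (B w) $ i) \<in> borel_measurable N"
proof -
  have h: "(\<lambda>w. h (A w) (Y w)) \<in> borel_measurable N" if A: "A \<in> borel_measurable N" for A
  proof (rule borel_measurable_caratheodory[where f = "\<lambda>w \<theta>. h \<theta> (Y w)", OF _ _ A])
    show "continuous_on UNIV (\<lambda>\<theta>. h \<theta> (Y w))" if "w \<in> space N" for w
      by (rule strongly_convex_smoothD(3)[OF h_convex[OF Y(2)[OF that]]])
    have "Y \<in> measurable N (restrict_space borel {-1..1})"
      using Y by (intro measurable_restrict_space2) auto
    then show "(\<lambda>w. h \<theta> (Y w)) \<in> borel_measurable N" for \<theta>
      using h_measurable by (rule measurable_compose)
  qed
  show ?thesis
  proof (rule borel_measurable_LIMSEQ_real)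
    fix w assume w: "w \<in> space N"
    from difference_quotient_tendsto_gradient[OF h_convex[OF Y(2)[OF w]], of "B w" "axis i 1"] \<mu>_pos
    show "(\<lambda>k. real (Suc k) * (h (B w + (1 / real (Suc k)) *\<^sub>R axis i 1) (Y w) - h (B w) (Y w)))
        \<longlonglongrightarrow> gradient (\<lambda>\<theta>. h \<theta> (Y w)) (B w) $ i"
      by (simp add: inner_axis)
  next
    fix k
    show "(\<lambda>w. real (Suc k) * (h (B w + (1 / real (Suc k)) *\<^sub>R axis i 1) (Y w) - h (B w) (Y w)))
        \<in> borel_measurable N"
      by (intro borel_measurable_times borel_measurable_diff borel_measurable_const h
            borel_measurable_add B)
  qed
qed

lemma borel_measurable_legendre [measurable (raw)]:
  assumes "Y \<in> borel_measurable N"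
  shows "(\<lambda>w. legendre n (Y w)) \<in> borel_measurable N"
  by (rule measurable_compose[OF assms borel_measurable_continuous_onI])
     (intro continuous_intros)

text \<open>Stated for arbitrary sample functions \<open>Y\<close>, since it is applied both to the
  samples on the probability space and to clamped coordinates of the product space.\<close>

lemma sgd_measurable:
  assumes Y: "\<And>t. t < T \<Longrightarrow> Y t \<in> borel_measurable N"
    and Y1: "\<And>t w. \<lbrakk>t < T; w \<in> space N\<rbrakk> \<Longrightarrow> Y t w \<in> {-1..1}"
  shows "(\<lambda>w. sgd h q \<eta> \<beta>\<^sub>0 (\<lambda>t. Y t w) T c) \<in> borel_measurable N"
  using assms
proof (induction T arbitrary: c)
  case (Suc T)
  obtain i n where c: "c = (i, n)" by (cases c)
  define \<beta> where "\<beta> w = sgd h q \<eta> \<beta>\<^sub>0 (\<lambda>t. Y t w) T" for w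
  have \<beta> [measurable]: "(\<lambda>w. \<beta> w c) \<in> borel_measurable N" for c
    unfolding \<beta>_def by (intro Suc.IH Suc.prems) auto
  have [measurable]: "Y T \<in> borel_measurable N" by (intro Suc.prems) simp
  have "(\<lambda>w. Phi_mult q (Y T w) (\<beta> w)) \<in> borel_measurable N"
    by (subst borel_measurable_euclidean_space) (auto simp: Basis_vec_def inner_axis Phi_mult_nth)
  then have [measurable]:
    "(\<lambda>w. gradient (\<lambda>\<theta>. h \<theta> (Y T w)) (Phi_mult q (Y T w) (\<beta> w)) $ i) \<in> borel_measurable N" for i
    by (intro gradient_nth_measurable Suc.prems) auto
  show ?case
    by (simp add: Let_def c Phi_transpose_mult_nth flip: \<beta>_def)
qed simp

text \<open>A supremum of reals says nothing before boundedness is known; here it comes from a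
  reference point that is uniformly close to the path.\<close>

lemma bdd_above_gap:
  assumes "\<And>l. l \<in> {-1..1} \<Longrightarrow> norm (Phi_mult q l b - \<theta>s l) \<le> \<delta>"
  shows "bdd_above ((\<lambda>l. h (Phi_mult q l \<beta>) l - h (\<theta>s l) l) ` {-1..1})"
    and "solution_path_error h \<theta>s q \<beta> \<le> L * (real q * (\<Sum>c\<in>coeff_index q. (\<beta> c - b c)\<^sup>2) + \<delta>\<^sup>2)"
    and "0 \<le> solution_path_error h \<theta>s q \<beta>"
proof -
  let ?B = "L * (real q * (\<Sum>c\<in>coeff_index q. (\<beta> c - b c)\<^sup>2) + \<delta>\<^sup>2)"
  have le: "h (Phi_mult q l \<beta>) l - h (\<theta>s l) l \<le> ?B" if l: "l \<in> {-1..1}" for l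
  proof -
    have "(norm (Phi_mult q l b - \<theta>s l))\<^sup>2 \<le> \<delta>\<^sup>2" using assms[OF l] by (intro power_mono) auto
    then have "L * (real q * (\<Sum>c\<in>coeff_index q. (\<beta> c - b c)\<^sup>2) + (norm (Phi_mult q l b - \<theta>s l))\<^sup>2) \<le> ?B"
      using L_pos by (intro mult_left_mono add_mono) auto
    with gap_le_distances[OF l, of q \<beta> b] show ?thesis by simp
  qed
  show bdd: "bdd_above ((\<lambda>l. h (Phi_mult q l \<beta>) l - h (\<theta>s l) l) ` {-1..1})"
    using le by (auto intro!: bdd_aboveI[of _ ?B])
  show "solution_path_error h \<theta>s q \<beta> \<le> ?B"
    unfolding solution_path_error_def using le by (intro cSUP_least) auto
  have "0 \<le> h (Phi_mult q 0 \<beta>) 0 - h (\<theta>s 0) 0" using h_min[of 0] by simp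
  also have "\<dots> \<le> solution_path_error h \<theta>s q \<beta>"
    unfolding solution_path_error_def by (intro cSUP_upper bdd) auto
  finally show "0 \<le> solution_path_error h \<theta>s q \<beta>" .
qed

text \<open>The error is a supremum over uncountably many \<open>\<lambda>\<close>, without any continuity in \<open>\<lambda>\<close>; it is
  measurable because it is lower semicontinuous in \<open>\<beta>\<close>.\<close>

lemma solution_path_error_measurable:
  assumes "\<And>l. l \<in> {-1..1} \<Longrightarrow> norm (Phi_mult q l b - \<theta>s l) \<le> \<delta>"
    and B: "\<And>c. (\<lambda>w. B w c) \<in> borel_measurable N"
  shows "(\<lambda>w. solution_path_error h \<theta>s q (B w)) \<in> borel_measurable N"
proof (rule measurable_compose[where g = "solution_path_error h \<theta>s q" and N = borel])
  \<comment> \<open>The index type \<open>'d \<times> nat\<close> is countable, so coordinatewise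
    measurability is enough for the Borel sets of the product topology.\<close>
  show "B \<in> borel_measurable N"
    by (rule measurable_coordinatewise_then_product) (rule B)
  show "solution_path_error h \<theta>s q \<in> borel_measurable borel"
  proof (rule borel_measurableI_greater)
    fix a
    have "{\<beta>. a < solution_path_error h \<theta>s q \<beta>}
       = (\<Union>l\<in>{-1..1}. {\<beta>. a < h (Phi_mult q l \<beta>) l - h (\<theta>s l) l})"
      unfolding solution_path_error_def
      using bdd_above_gap(1)[OF assms(1)] by (subst less_cSUP_iff) auto
    moreover have "open {\<beta>. a < h (Phi_mult q l \<beta>) l - h (\<theta>s l) l}" if "l \<in> {-1..1}" for l
    proof (rule open_Collect_less)
      have "continuous_on UNIV (\<lambda>\<beta>. Phi_mult q l \<beta>)"
        unfolding Phi_mult_def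
        by (intro continuous_intros continuous_on_product_coordinates)
      then have "continuous_on UNIV (\<lambda>\<beta>. h (Phi_mult q l \<beta>) l)"
        by (rule continuous_on_compose2[OF strongly_convex_smoothD(3)[OF h_convex[OF that]]]) auto
      then show "continuous_on UNIV (\<lambda>\<beta>. h (Phi_mult q l \<beta>) l - h (\<theta>s l) l)"
        by (intro continuous_intros)
    qed (intro continuous_intros)
    ultimately have "open {\<beta>. a < solution_path_error h \<theta>s q \<beta>}" by (simp add: open_UN)
    then show "{\<beta> \<in> space borel. a < solution_path_error h \<theta>s q \<beta>} \<in> sets borel" by simp
  qed
qed

end

section \<open>Expected error\<close>

text \<open>Independence of the next sample from the current iterate rests on this.\<close>

lemma sgd_cong:
  assumes "\<And>i. i < T \<Longrightarrow> s i = s' i"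
  shows "sgd h q \<eta> \<beta>\<^sub>0 s T = sgd h q \<eta> \<beta>\<^sub>0 s' T"
  using assms by (induction T) (auto simp: Let_def)

lemma density_uniform_lborel:
  "uniform_measure lborel {-1..1::real} = density lborel (\<lambda>x. ennreal (indicator {-1..1} x / 2))"
  unfolding uniform_measure_def
  by (intro arg_cong2[where f = density] ext refl)
     (auto simp: indicator_def divide_ennreal[symmetric] simp flip: ennreal_numeral)

locale uniform_samples = prob_space M for M :: "'w measure" +
  fixes X :: "nat \<Rightarrow> 'w \<Rightarrow> real"
  assumes X_range: "\<And>t w. w \<in> space M \<Longrightarrow> X t w \<in> {-1..1}"
    and X_indep: "indep_vars (\<lambda>_. borel) X UNIV"
    and X_distr: "\<And>t. distr M borel (X t) = uniform_measure lborel {-1..1}"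
begin

lemma X_measurable [measurable]: "X t \<in> borel_measurable M"
  using X_indep by (simp add: indep_vars_def)

lemma uniform_sample:
  fixes g :: "real \<Rightarrow> real"
  assumes cont: "continuous_on {-1..1} g"
  shows "integrable M (\<lambda>w. g (X t w))"
    and "expectation (\<lambda>w. g (X t w)) = integral {-1..1} g / 2"
proof -
  \<comment> \<open>\<open>g\<close> is known to be continuous only on the interval; cutting it off
    by zero gives a Borel function on the whole line.\<close>
  define G where "G x = indicator {-1..1} x *\<^sub>R g x" for x
  have G [measurable]: "G \<in> borel_measurable borel"
    unfolding G_def by (intro borel_measurable_continuous_on_indicator cont) auto
  have eq: "g (X t w) = G (X t w)" if "w \<in> space M" for w
    using X_range[OF that] by (simp add: G_def)
  have int: "integrable lborel G"
    unfolding G_def by (intro borel_integrable_compact cont) auto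
  have "compact (g ` {-1..1})" by (intro compact_continuous_image cont) auto
  then obtain B where B: "\<And>x. x \<in> {-1..1} \<Longrightarrow> \<bar>g x\<bar> \<le> B"
    using compact_imp_bounded[of "g ` {-1..1}"] unfolding bounded_iff by (metis imageI real_norm_def)
  have "integrable M (\<lambda>w. G (X t w))"
  proof (rule integrable_const_bound[of _ B])
    show "AE w in M. norm (G (X t w)) \<le> B"
      using B X_range eq by (intro AE_I2) (metis real_norm_def)
  qed measurable
  then show "integrable M (\<lambda>w. g (X t w))"
    by (rule Bochner_Integration.integrable_cong[THEN iffD2, rotated -1]) (auto simp: eq)
  have "expectation (\<lambda>w. g (X t w)) = expectation (\<lambda>w. G (X t w))"
    by (intro Bochner_Integration.integral_cong) (auto simp: eq)
  also have "\<dots> = integral\<^sup>L (uniform_measure lborel {-1..1}) G"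
    by (subst integral_distr[symmetric, of "X t" M borel G]) (auto simp: X_distr)
  also have "\<dots> = integral\<^sup>L lborel (\<lambda>x. (indicator {-1..1} x / 2) *\<^sub>R G x)"
    unfolding density_uniform_lborel by (intro integral_density) auto
  also have "\<dots> = integral\<^sup>L lborel (\<lambda>x. G x / 2)"
    by (intro Bochner_Integration.integral_cong) (auto simp: G_def indicator_def)
  also have "\<dots> = (LINT x:{-1..1}|lborel. g x) / 2"
    by (simp add: set_lebesgue_integral_def G_def)
  also have "(LINT x:{-1..1}|lborel. g x) = integral {-1..1} g"
    using int unfolding G_def[abs_def]
    by (intro set_borel_integral_eq_integral) (simp add: set_integrable_def)
  finally show "expectation (\<lambda>w. g (X t w)) = integral {-1..1} g / 2" .
qed

text \<open>Entries of one block of the averaged Gram matrix; the density 1 / 2 cancels the 2 in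
  \<open>legendre_norm\<close>.\<close>

lemma expectation_legendre_mult:
  "expectation (\<lambda>w. legendre n (X t w) * legendre m (X t w)) = (if n = m then 1 / real (2 * n + 1) else 0)"
  by (subst uniform_sample(2)) (auto intro!: continuous_intros simp: legendre_orthogonal legendre_norm)

end

section \<open>Expected distance of the iterates to the reference point\<close>

locale sgd_run = solution_path h \<theta>s \<mu> L + uniform_samples M X
  for h :: "real ^ 'd::finite \<Rightarrow> real \<Rightarrow> real" and \<theta>s :: "real \<Rightarrow> real ^ 'd" and \<mu> L :: real
    and M :: "'w measure" and X :: "nat \<Rightarrow> 'w \<Rightarrow> real" +
  fixes q :: nat and \<eta> :: real and \<beta>\<^sub>0 b :: "'d \<times> nat \<Rightarrow> real" and \<delta> :: real
  assumes q_pos: "0 < q" and \<eta>_pos: "0 < \<eta>" and \<eta>_le: "\<eta> * (real q * L) \<le> 1"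
    and b_sup: "\<And>l. l \<in> {-1..1} \<Longrightarrow> norm (Phi_mult q l b - \<theta>s l) \<le> \<delta>"
    and b_cont: "continuous_on {-1..1} (\<lambda>l. (norm (Phi_mult q l b - \<theta>s l))\<^sup>2)"
begin

definition iterate :: "nat \<Rightarrow> 'w \<Rightarrow> 'd \<times> nat \<Rightarrow> real" where
  "iterate t w = sgd h q \<eta> \<beta>\<^sub>0 (\<lambda>i. X i w) t"

definition sqdist :: "nat \<Rightarrow> 'w \<Rightarrow> real" where
  "sqdist t w = (\<Sum>c\<in>coeff_index q. (iterate t w c - b c)\<^sup>2)"

lemma iterate_measurable [measurable]: "(\<lambda>w. iterate t w c) \<in> borel_measurable M"
  unfolding iterate_def by (intro sgd_measurable) (use X_range in auto)

lemma sqdist_measurable [measurable]: "sqdist t \<in> borel_measurable M"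
  unfolding sqdist_def by measurable

lemma sqdist_Suc_le:
  assumes "w \<in> space M"
  shows "sqdist (Suc t) w \<le> sqdist t w
      - \<eta> * \<mu> * (norm (Phi_mult q (X t w) (\<lambda>c. iterate t w c - b c)))\<^sup>2
      + \<eta> * L * (norm (Phi_mult q (X t w) b - \<theta>s (X t w)))\<^sup>2"
  using sgd_step[OF X_range[OF assms] \<eta>_pos \<eta>_le, where \<beta> = "iterate t w" and b = b]
  by (simp add: sqdist_def iterate_def Let_def)

text \<open>On every sample path one step adds at most \<open>\<eta> * L * \<delta>\<^sup>2\<close>.
  Integrability of everything built from the iterates is reduced to this bound.\<close>

lemma sqdist_bounded: "\<exists>B. \<forall>w\<in>space M. sqdist t w \<le> B"
proof (induction t)
  case 0
  show ?case by (auto simp: sqdist_def iterate_def)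
next
  case (Suc t)
  then obtain B where B: "\<And>w. w \<in> space M \<Longrightarrow> sqdist t w \<le> B" by blast
  have "sqdist (Suc t) w \<le> B + \<eta> * L * \<delta>\<^sup>2" if w: "w \<in> space M" for w
  proof -
    have "0 \<le> \<eta> * \<mu> * (norm (Phi_mult q (X t w) (\<lambda>c. iterate t w c - b c)))\<^sup>2"
      using \<eta>_pos \<mu>_pos by simp
    moreover have "\<eta> * L * (norm (Phi_mult q (X t w) b - \<theta>s (X t w)))\<^sup>2 \<le> \<eta> * L * \<delta>\<^sup>2"
      using \<eta>_pos L_pos b_sup[OF X_range[OF w]] by (intro mult_left_mono power_mono) auto
    ultimately show ?thesis using sqdist_Suc_le[OF w, of t] B[OF w] by linarith
  qed
  then show ?case by blast
qed

lemma sqdist_nonneg: "0 \<le> sqdist t w"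
  unfolding sqdist_def by (intro sum_nonneg) auto

lemma sqdist_integrable: "integrable M (sqdist t)"
proof -
  obtain B where "\<And>w. w \<in> space M \<Longrightarrow> sqdist t w \<le> B" using sqdist_bounded by blast
  then show ?thesis
    by (intro integrable_const_bound[of _ B] AE_I2) (auto simp: sqdist_nonneg)
qed

lemma finite_coeff_index: "finite (coeff_index q :: ('d \<times> nat) set)"
  by (simp add: coeff_index_def)

lemma deviation_product_integrable:
  assumes "c \<in> coeff_index q" "c' \<in> coeff_index q"
  shows "integrable M (\<lambda>w. (iterate t w c - b c) * (iterate t w c' - b c'))"
proof -
  obtain B where B: "\<And>w. w \<in> space M \<Longrightarrow> sqdist t w \<le> B" using sqdist_bounded by blast
  have le: "(iterate t w d - b d)\<^sup>2 \<le> B" if "w \<in> space M" "d \<in> coeff_index q" for w d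
  proof -
    have "(iterate t w d - b d)\<^sup>2 \<le> sqdist t w"
      unfolding sqdist_def by (rule member_le_sum[OF that(2)]) (auto simp: finite_coeff_index)
    with B[OF that(1)] show ?thesis by simp
  qed
  have "\<bar>(iterate t w c - b c) * (iterate t w c' - b c')\<bar> \<le> B" if w: "w \<in> space M" for w
  proof -
    have "2 * \<bar>iterate t w c - b c\<bar> * \<bar>iterate t w c' - b c'\<bar>
        \<le> \<bar>iterate t w c - b c\<bar>\<^sup>2 + \<bar>iterate t w c' - b c'\<bar>\<^sup>2"
      by (rule sum_squares_bound)
    with le[OF w assms(1)] le[OF w assms(2)] show ?thesis by (simp add: abs_mult)
  qed
  then show ?thesis
    by (intro integrable_const_bound[of _ B] AE_I2) (auto intro!: borel_measurable_times borel_measurable_diff)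
qed

text \<open>Step \<open>t\<close> uses \<open>X t\<close>, while \<open>iterate t\<close> depends
  only on earlier samples, so the random Gram entry may be averaged on its own.\<close>

lemma expectation_sample_mult_deviation:
  fixes n m t :: nat
  assumes c: "c \<in> coeff_index q" "c' \<in> coeff_index q"
  defines "Y \<equiv> \<lambda>w. legendre n (X t w) * legendre m (X t w)"
    and "Z \<equiv> \<lambda>w. (iterate t w c - b c) * (iterate t w c' - b c')"
  shows "integrable M (\<lambda>w. Y w * Z w)"
    and "expectation (\<lambda>w. Y w * Z w) = (if n = m then 1 / real (2 * n + 1) else 0) * expectation Z"
proof -
  text \<open>\<open>h\<close> is only measurable for parameters in \<open>[-1, 1]\<close>, so the iterate becomes a function on the
    whole product space of samples after clamping.\<close>
  define clamp where "clamp x = max (-1) (min 1 x)" for x :: real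
  define \<beta> where "\<beta> s = sgd h q \<eta> \<beta>\<^sub>0 (\<lambda>i. clamp (s i)) t" for s
  define Y' where "Y' s = legendre n (s t) * legendre m (s t)" for s :: "nat \<Rightarrow> real"
  define Z' where "Z' s = (\<beta> s c - b c) * (\<beta> s c' - b c')" for s
  define R where "R A w = (\<lambda>i\<in>A. X i w)" for A w
  have "indep_var (PiM {t} (\<lambda>_. borel)) (R {t}) (PiM {..<t} (\<lambda>_. borel)) (R {..<t})"
    unfolding R_def by (rule indep_var_restrict[OF X_indep]) auto
  moreover have "Y' \<in> borel_measurable (PiM {t} (\<lambda>_. borel))"
    unfolding Y'_def by measurable
  moreover have "(\<lambda>s. \<beta> s d) \<in> borel_measurable (PiM {..<t} (\<lambda>_. borel))" for d
    unfolding \<beta>_def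
  proof (rule sgd_measurable)
    show "(\<lambda>s. clamp (s i)) \<in> borel_measurable (PiM {..<t} (\<lambda>_. borel))" if "i < t" for i
      unfolding clamp_def using that
      by (intro borel_measurable_max borel_measurable_min borel_measurable_const measurable_component_singleton) simp
  qed (simp add: clamp_def)
  then have "Z' \<in> borel_measurable (PiM {..<t} (\<lambda>_. borel))"
    unfolding Z'_def by measurable
  ultimately have indep: "indep_var borel (Y' \<circ> R {t}) borel (Z' \<circ> R {..<t})"
    by (rule indep_var_compose)
  have Y: "(Y' \<circ> R {t}) w = Y w" for w
    by (simp add: Y'_def Y_def R_def)
  have Z: "(Z' \<circ> R {..<t}) w = Z w" if "w \<in> space M" for w
  proof -
    have "\<beta> (R {..<t} w) = iterate t w"
      unfolding \<beta>_def iterate_def R_def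
      using X_range[OF that] by (intro sgd_cong) (simp add: clamp_def)
    then show ?thesis by (simp add: Z'_def Z_def)
  qed
  have intY: "integrable M Y"
    unfolding Y_def by (rule uniform_sample) (intro continuous_intros)
  have intZ: "integrable M Z"
    unfolding Z_def by (rule deviation_product_integrable[OF c])
  have intY': "integrable M (Y' \<circ> R {t})"
    using intY Y by (simp add: fun_eq_iff cong: Bochner_Integration.integrable_cong)
  have intZ': "integrable M (Z' \<circ> R {..<t})"
    using intZ Z by (simp cong: Bochner_Integration.integrable_cong)
  have "expectation (\<lambda>w. Y w * Z w) = expectation (\<lambda>w. (Y' \<circ> R {t}) w * (Z' \<circ> R {..<t}) w)"
    using Y Z by (intro Bochner_Integration.integral_cong) auto
  also have "\<dots> = expectation (Y' \<circ> R {t}) * expectation (Z' \<circ> R {..<t})"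
    by (rule indep_var_lebesgue_integral[OF indep intY' intZ'])
  also have "expectation (Y' \<circ> R {t}) = expectation Y"
    using Y by (intro Bochner_Integration.integral_cong) auto
  also have "expectation (Z' \<circ> R {..<t}) = expectation Z"
    using Z by (intro Bochner_Integration.integral_cong) auto
  finally show "expectation (\<lambda>w. Y w * Z w) = (if n = m then 1 / real (2 * n + 1) else 0) * expectation Z"
    unfolding Y_def by (simp only: expectation_legendre_mult)
  have "integrable M (\<lambda>w. (Y' \<circ> R {t}) w * (Z' \<circ> R {..<t}) w)"
    by (rule indep_var_integrable[OF indep intY' intZ'])
  then show "integrable M (\<lambda>w. Y w * Z w)"
    using Y Z by (simp cong: Bochner_Integration.integrable_cong)
qed

lemma norm_Phi_mult_deviation:
  "(norm (Phi_mult q l (\<lambda>c. iterate t w c - b c)))\<^sup>2 =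
    (\<Sum>i\<in>UNIV. \<Sum>n<q. \<Sum>m<q. (legendre n l * legendre m l) *
       ((iterate t w (i, n) - b (i, n)) * (iterate t w (i, m) - b (i, m))))"
  unfolding norm_vec_square Phi_mult_nth by (simp add: power2_eq_square sum_product mult_ac)

lemma integrable_norm_Phi_mult_deviation:
  "integrable M (\<lambda>w. (norm (Phi_mult q (X t w) (\<lambda>c. iterate t w c - b c)))\<^sup>2)"
  unfolding norm_Phi_mult_deviation
  by (intro Bochner_Integration.integrable_sum expectation_sample_mult_deviation)
     (auto simp: coeff_index_def)

text \<open>After averaging only the diagonal survives, with weights \<open>1 / (2 * n + 1)\<close>
  for \<open>n < q\<close>; these are bounded below by the slightly weaker but simpler
  \<open>1 / (2 * q)\<close>.\<close>

lemma expectation_norm_Phi_mult_deviation_ge: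
  "expectation (sqdist t) / real (2 * q)
     \<le> expectation (\<lambda>w. (norm (Phi_mult q (X t w) (\<lambda>c. iterate t w c - b c)))\<^sup>2)"
proof -
  let ?Z = "\<lambda>i n m w. (iterate t w (i, n) - b (i, n)) * (iterate t w (i, m) - b (i, m))"
  have I: "(i, n) \<in> coeff_index q" if "n < q" for i :: 'd and n
    using that by (simp add: coeff_index_def)
  let ?F = "\<lambda>i n m w. (legendre n (X t w) * legendre m (X t w)) * ?Z i n m w"
  have F: "integrable M (?F i n m)" if "n < q" "m < q" for i n m
    using that by (intro expectation_sample_mult_deviation I)
  have Z: "integrable M (?Z i n n)" if "n < q" for i n
    using that by (intro deviation_product_integrable I)
  have "expectation (sqdist t) = expectation (\<lambda>w. \<Sum>i\<in>UNIV. \<Sum>n<q. ?Z i n n w)"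
    unfolding sqdist_def sum_coeff_index power2_eq_square ..
  also have "\<dots> = (\<Sum>i\<in>UNIV. expectation (\<lambda>w. \<Sum>n<q. ?Z i n n w))"
    by (intro Bochner_Integration.integral_sum Bochner_Integration.integrable_sum Z) auto
  also have "\<dots> = (\<Sum>i\<in>UNIV. \<Sum>n<q. expectation (?Z i n n))"
    by (intro sum.cong refl Bochner_Integration.integral_sum Z) auto
  finally have "expectation (sqdist t) / real (2 * q) = (\<Sum>i\<in>UNIV. \<Sum>n<q. 1 / real (2 * q) * expectation (?Z i n n))"
    by (simp add: sum_divide_distrib)
  also have "\<dots> \<le> (\<Sum>i\<in>UNIV. \<Sum>n<q. 1 / real (2 * n + 1) * expectation (?Z i n n))"
  proof (intro sum_mono mult_right_mono)
    show "1 / real (2 * q) \<le> 1 / real (2 * n + 1)" if "n \<in> {..<q}" for n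
      using that by (intro divide_left_mono) auto
  qed (auto intro!: Bochner_Integration.integral_nonneg)
  also have "\<dots> = (\<Sum>i\<in>UNIV. \<Sum>n<q. \<Sum>m<q. (if n = m then 1 / real (2 * n + 1) else 0) * expectation (?Z i n m))"
    by (simp add: if_distrib[of "\<lambda>x. x * _"] cong: if_cong)
  also have "\<dots> = (\<Sum>i\<in>UNIV. \<Sum>n<q. \<Sum>m<q. expectation (?F i n m))"
    by (intro sum.cong refl expectation_sample_mult_deviation(2)[symmetric]) (auto simp: I)
  also have "\<dots> = (\<Sum>i\<in>UNIV. \<Sum>n<q. expectation (\<lambda>w. \<Sum>m<q. ?F i n m w))"
    by (intro sum.cong refl Bochner_Integration.integral_sum[symmetric] F) auto
  also have "\<dots> = (\<Sum>i\<in>UNIV. expectation (\<lambda>w. \<Sum>n<q. \<Sum>m<q. ?F i n m w))"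
    by (intro sum.cong refl Bochner_Integration.integral_sum[symmetric] Bochner_Integration.integrable_sum F) auto
  also have "\<dots> = expectation (\<lambda>w. \<Sum>i\<in>UNIV. \<Sum>n<q. \<Sum>m<q. ?F i n m w)"
    by (intro Bochner_Integration.integral_sum[symmetric] Bochner_Integration.integrable_sum F) auto
  also have "\<dots> = expectation (\<lambda>w. (norm (Phi_mult q (X t w) (\<lambda>c. iterate t w c - b c)))\<^sup>2)"
    unfolding norm_Phi_mult_deviation ..
  finally show ?thesis .
qed

definition residual :: real where
  "residual = integral {-1..1} (\<lambda>l. (norm (Phi_mult q l b - \<theta>s l))\<^sup>2) / 2"

lemma expectation_sqdist_Suc_le:
  "expectation (sqdist (Suc t)) \<le> (1 - \<eta> * \<mu> / real (2 * q)) * expectation (sqdist t) + \<eta> * L * residual"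
proof -
  note int = sqdist_integrable[of t] integrable_norm_Phi_mult_deviation[of t] uniform_sample(1)[OF b_cont, of t]
  have "expectation (sqdist (Suc t)) \<le> expectation (\<lambda>w. sqdist t w
      - \<eta> * \<mu> * (norm (Phi_mult q (X t w) (\<lambda>c. iterate t w c - b c)))\<^sup>2
      + \<eta> * L * (norm (Phi_mult q (X t w) b - \<theta>s (X t w)))\<^sup>2)"
    by (intro integral_mono Bochner_Integration.integrable_add Bochner_Integration.integrable_diff
          integrable_mult_right int sqdist_integrable sqdist_Suc_le)
  also have "\<dots> = expectation (sqdist t)
      - \<eta> * \<mu> * expectation (\<lambda>w. (norm (Phi_mult q (X t w) (\<lambda>c. iterate t w c - b c)))\<^sup>2)
      + \<eta> * L * residual"
    using int uniform_sample(2)[OF b_cont, of t] by (simp add: residual_def)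
  also have "\<dots> \<le> expectation (sqdist t) - \<eta> * \<mu> * (expectation (sqdist t) / real (2 * q)) + \<eta> * L * residual"
    using expectation_norm_Phi_mult_deviation_ge[of t] \<eta>_pos \<mu>_pos
    by (intro add_right_mono diff_left_mono mult_left_mono) auto
  finally show ?thesis by (simp add: left_diff_distrib)
qed

text \<open>Keeps the contraction factor nonnegative, as iterating the recursion and bounding its
  powers by an exponential require.\<close>

lemma contraction_le_1: "\<eta> * \<mu> / real (2 * q) \<le> 1"
proof -
  have "\<eta> * \<mu> \<le> \<eta> * (real q * L)"
    using \<eta>_pos \<mu>_le_L \<mu>_pos L_pos q_pos mult_mono[of 1 "real q" \<mu> L] by (intro mult_left_mono) auto
  with \<eta>_le q_pos show ?thesis by simp
qed

lemma residual_nonneg: "0 \<le> residual"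
  unfolding residual_def
  by (intro divide_nonneg_pos integral_nonneg integrable_continuous_real b_cont) auto

text \<open>The additive constant is the fixed point of the one-step recursion, in which the step
  size cancels.\<close>

lemma expectation_sqdist_le:
  "expectation (sqdist t) \<le> (1 - \<eta> * \<mu> / real (2 * q)) ^ t * (\<Sum>c\<in>coeff_index q. (\<beta>\<^sub>0 c - b c)\<^sup>2)
     + 2 * real q * L * residual / \<mu>"
proof (induction t)
  case 0
  have "0 \<le> 2 * real q * L * residual / \<mu>" using residual_nonneg L_pos \<mu>_pos by simp
  then show ?case by (simp add: sqdist_def iterate_def prob_space)
next
  case (Suc t)
  let ?r = "\<eta> * \<mu> / real (2 * q)" and ?D = "\<Sum>c\<in>coeff_index q. (\<beta>\<^sub>0 c - b c)\<^sup>2"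
  have "expectation (sqdist (Suc t)) \<le> (1 - ?r) * expectation (sqdist t) + \<eta> * L * residual"
    by (rule expectation_sqdist_Suc_le)
  also have "\<dots> \<le> (1 - ?r) * ((1 - ?r) ^ t * ?D + 2 * real q * L * residual / \<mu>) + \<eta> * L * residual"
    using Suc contraction_le_1 by (intro add_right_mono mult_left_mono) auto
  also have "\<dots> = (1 - ?r) ^ Suc t * ?D + 2 * real q * L * residual / \<mu>"
    using \<mu>_pos q_pos by (simp add: field_simps)
  finally show ?case .
qed

text \<open>Integrability is claimed too, since the Bochner integral of a non-integrable function is
  0 and the bound alone could hold vacuously.\<close>

lemma expected_error:
  "integrable M (\<lambda>w. solution_path_error h \<theta>s q (iterate t w))"
  "expectation (\<lambda>w. solution_path_error h \<theta>s q (iterate t w))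
     \<le> L * (real q * ((1 - \<eta> * \<mu> / real (2 * q)) ^ t * (\<Sum>c\<in>coeff_index q. (\<beta>\<^sub>0 c - b c)\<^sup>2)
          + 2 * real q * L * residual / \<mu>) + \<delta>\<^sup>2)"
proof -
  let ?err = "\<lambda>w. solution_path_error h \<theta>s q (iterate t w)"
  have le: "?err w \<le> L * (real q * sqdist t w + \<delta>\<^sup>2)" and nonneg: "0 \<le> ?err w" for w
    using bdd_above_gap(2,3)[where b = b and \<beta> = "iterate t w" and \<delta> = \<delta> and q = q, OF b_sup]
    by (simp_all add: sqdist_def)
  have int: "integrable M (\<lambda>w. L * (real q * sqdist t w + \<delta>\<^sup>2))"
    using sqdist_integrable[of t] by simp
  show interr: "integrable M ?err"
  proof (rule Bochner_Integration.integrable_bound[OF int])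
    show "?err \<in> borel_measurable M"
      by (rule solution_path_error_measurable[OF b_sup]) auto
    show "AE w in M. norm (?err w) \<le> norm (L * (real q * sqdist t w + \<delta>\<^sup>2))"
      using le nonneg by (intro AE_I2) (auto intro: order_trans[OF _ abs_ge_self])
  qed
  have "expectation ?err \<le> expectation (\<lambda>w. L * (real q * sqdist t w + \<delta>\<^sup>2))"
    by (intro integral_mono interr int le)
  also have "\<dots> = L * (real q * expectation (sqdist t) + \<delta>\<^sup>2)"
    using sqdist_integrable[of t] by (simp add: prob_space)
  also have "\<dots> \<le> L * (real q * ((1 - \<eta> * \<mu> / real (2 * q)) ^ t * (\<Sum>c\<in>coeff_index q. (\<beta>\<^sub>0 c - b c)\<^sup>2)
          + 2 * real q * L * residual / \<mu>) + \<delta>\<^sup>2)"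
    using L_pos expectation_sqdist_le by (intro mult_left_mono add_right_mono) auto
  finally show "expectation ?err \<le> \<dots>" .
qed

end

section \<open>Choice of the parameters\<close>

text \<open>\<open>q\<close> makes the first term at most \<epsilon> / 2, then \<open>T\<close> does
  so for the second. The factor \<open>q ^ N\<close> is harmless: \<open>q\<close> is a power of 1 /
  \<epsilon> up to constants, so the logarithm of \<open>q ^ N / \<epsilon>\<close> is still of
  order ln (1 / \<epsilon>).\<close>

lemma sgd_parameter_choice:
  fixes C r :: real and \<nu> N :: nat
  assumes C: "0 < C" and r: "0 < r" and \<nu>: "2 \<le> \<nu>"
  shows "\<exists>(q :: real \<Rightarrow> nat) (T :: real \<Rightarrow> nat).
    (\<lambda>\<epsilon>. real (q \<epsilon>)) \<in> O[at_right 0](\<lambda>\<epsilon>. \<epsilon> powr (1 / (2 * (1 - real \<nu>)))) \<and>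
    (\<lambda>\<epsilon>. real (T \<epsilon>)) \<in> O[at_right 0](\<lambda>\<epsilon>. \<epsilon> powr (1 / (1 - real \<nu>)) * ln (1 / \<epsilon>)) \<and>
    (\<forall>\<epsilon>>0. 1 \<le> q \<epsilon> \<and> C / real (q \<epsilon>) ^ (2 * (\<nu> - 1))
        + C * real (q \<epsilon>) ^ N * exp (- r * real (T \<epsilon>) / (real (q \<epsilon>))\<^sup>2) \<le> \<epsilon>)"
proof -
  define m where "m = 2 * (\<nu> - 1)"
  define p where "p = 1 / real m"
  have m: "m > 0" and p: "p > 0" using \<nu> by (auto simp: m_def p_def)
  have exponents: "1 / (2 * (1 - real \<nu>)) = - p" "1 / (1 - real \<nu>) = - (2 * p)"
    using \<nu> by (auto simp: p_def m_def of_nat_diff field_simps)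
  define x where "x \<epsilon> = (2 * C / \<epsilon>) powr p" for \<epsilon>
  define q where "q \<epsilon> = nat \<lceil>x \<epsilon>\<rceil> + 1" for \<epsilon>
  \<comment> \<open>The summand 1 keeps the logarithm nonnegative for large \<epsilon> as
    well.\<close>
  define l where "l \<epsilon> = ln (1 + 2 * C * real (q \<epsilon>) ^ N / \<epsilon>)" for \<epsilon>
  define T where "T \<epsilon> = nat \<lceil>(real (q \<epsilon>))\<^sup>2 / r * l \<epsilon>\<rceil>" for \<epsilon>
  have l: "0 \<le> l \<epsilon>" "exp (l \<epsilon>) = 1 + 2 * C * real (q \<epsilon>) ^ N / \<epsilon>" if "\<epsilon> > 0" for \<epsilon>
  proof -
    have *: "0 \<le> 2 * C * real (q \<epsilon>) ^ N / \<epsilon>" using that C by simp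
    show "0 \<le> l \<epsilon>" unfolding l_def using * by (intro ln_ge_zero) simp
    show "exp (l \<epsilon>) = 1 + 2 * C * real (q \<epsilon>) ^ N / \<epsilon>"
      unfolding l_def using * by (intro exp_ln) simp
  qed
  have small: "C / real (q \<epsilon>) ^ m + C * real (q \<epsilon>) ^ N * exp (- r * real (T \<epsilon>) / (real (q \<epsilon>))\<^sup>2) \<le> \<epsilon>"
    if \<epsilon>: "\<epsilon> > 0" for \<epsilon>
  proof -
    have q: "0 < real (q \<epsilon>)" by (simp add: q_def)
    have "2 * C / \<epsilon> = x \<epsilon> ^ m"
      using C \<epsilon> m by (simp add: x_def p_def powr_power)
    also have "\<dots> \<le> real (q \<epsilon>) ^ m"
    proof (intro power_mono)
      show "x \<epsilon> \<le> real (q \<epsilon>)" unfolding q_def by linarith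
    qed (simp add: x_def)
    finally have 1: "2 * (C / real (q \<epsilon>) ^ m) \<le> \<epsilon>"
      using \<epsilon> q by (simp add: field_simps)
    have "(real (q \<epsilon>))\<^sup>2 / r * l \<epsilon> \<le> real (T \<epsilon>)" unfolding T_def by linarith
    then have "l \<epsilon> \<le> r * real (T \<epsilon>) / (real (q \<epsilon>))\<^sup>2" using q r by (simp add: field_simps)
    then have "exp (- r * real (T \<epsilon>) / (real (q \<epsilon>))\<^sup>2) \<le> exp (- l \<epsilon>)" by simp
    also have "\<dots> = 1 / (1 + 2 * C * real (q \<epsilon>) ^ N / \<epsilon>)"
      by (simp add: exp_minus l(2)[OF \<epsilon>] inverse_eq_divide)
    also have "\<dots> \<le> 1 / (2 * C * real (q \<epsilon>) ^ N / \<epsilon>)"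
      using C q \<epsilon> by (intro divide_left_mono) (auto intro!: mult_pos_pos add_pos_pos divide_pos_pos)
    finally have "C * real (q \<epsilon>) ^ N * exp (- r * real (T \<epsilon>) / (real (q \<epsilon>))\<^sup>2)
        \<le> C * real (q \<epsilon>) ^ N * (1 / (2 * C * real (q \<epsilon>) ^ N / \<epsilon>))"
      using C by (intro mult_left_mono) auto
    also have "\<dots> = \<epsilon> / 2" using C q by simp
    finally show ?thesis using 1 by linarith
  qed
  have e1: "1 \<le> \<epsilon> powr (- a)" if "0 < \<epsilon>" "\<epsilon> \<le> 1" "0 \<le> a" for \<epsilon> a :: real
    using powr_le1[of a \<epsilon>] that by (simp add: powr_minus_divide)
  define A where "A = (2 * C) powr p + 2"
  have A: "A \<ge> 0" by (simp add: A_def)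
  have q_le: "real (q \<epsilon>) \<le> A * \<epsilon> powr (- p)" if \<epsilon>: "0 < \<epsilon>" "\<epsilon> \<le> 1" for \<epsilon>
  proof -
    have "0 \<le> x \<epsilon>" by (simp add: x_def)
    then have "real (q \<epsilon>) \<le> x \<epsilon> + 2" unfolding q_def by linarith
    also have "x \<epsilon> = (2 * C) powr p * \<epsilon> powr (- p)"
      using C \<epsilon> by (simp add: x_def powr_divide powr_minus_divide)
    also have "(2 * C) powr p * \<epsilon> powr (- p) + 2 \<le> (2 * C) powr p * \<epsilon> powr (- p) + 2 * \<epsilon> powr (- p)"
      using e1[OF \<epsilon>, of p] p by simp
    finally show ?thesis by (simp add: A_def algebra_simps)
  qed
  have "(\<lambda>\<epsilon>. real (q \<epsilon>)) \<in> O[at_right 0](\<lambda>\<epsilon>. \<epsilon> powr (- p))"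
  proof (rule bigoI)
    show "\<forall>\<^sub>F \<epsilon> in at_right 0. norm (real (q \<epsilon>)) \<le> A * norm (\<epsilon> powr (- p))"
      by (rule eventually_mono[OF eventually_at_right_real[OF zero_less_one]]) (use q_le in auto)
  qed
  moreover
  \<comment> \<open>In the exponent \<open>p * real N + 1\<close>, the first summand stems from
    \<open>q ^ N\<close> and the second from the division by \<epsilon>.\<close>
  define B where "B = ln (1 + 2 * C * A ^ N) + (p * real N + 1)"
  have B0: "B \<ge> 0" unfolding B_def using C A p by (intro add_nonneg_nonneg ln_ge_zero) auto
  have "(\<lambda>\<epsilon>. real (T \<epsilon>)) \<in> O[at_right 0](\<lambda>\<epsilon>. \<epsilon> powr (- (2 * p)) * ln (1 / \<epsilon>))"
  proof (rule bigoI)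
    \<comment> \<open>Below \<open>exp (- 1)\<close> the logarithm is at least 1 and absorbs
      additive constants.\<close>
    have "real (T \<epsilon>) \<le> (A\<^sup>2 / r * B + 1) * (\<epsilon> powr (- (2 * p)) * ln (1 / \<epsilon>))"
      if \<epsilon>: "0 < \<epsilon>" "\<epsilon> < exp (- 1)" for \<epsilon>
    proof -
      have "\<epsilon> \<le> 1" using \<epsilon> exp_le_one_iff[of "-1"] by linarith
      note q = q_le[OF \<epsilon>(1) this]
      have "ln \<epsilon> < ln (exp (- 1))" using \<epsilon> by (subst ln_less_cancel_iff) auto
      then have ln1: "1 \<le> ln (1 / \<epsilon>)" using \<epsilon> by (simp add: ln_div)
      note e1 = e1[OF \<epsilon>(1) \<open>\<epsilon> \<le> 1\<close>]
      have "1 + 2 * C * real (q \<epsilon>) ^ N / \<epsilon> \<le> \<epsilon> powr (- (p * real N + 1)) + 2 * C * (A * \<epsilon> powr (- p)) ^ N / \<epsilon>"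
        using C \<epsilon> q p by (intro add_mono e1 divide_right_mono mult_left_mono power_mono) auto
      also have "(A * \<epsilon> powr (- p)) ^ N = A ^ N * \<epsilon> powr (- (p * real N))"
        using \<epsilon> by (simp add: power_mult_distrib powr_power mult.commute)
      also have "2 * C * (A ^ N * \<epsilon> powr (- (p * real N))) / \<epsilon> = 2 * C * A ^ N * \<epsilon> powr (- (p * real N + 1))"
        using \<epsilon> powr_diff[of \<epsilon> "- (p * real N)" 1] by simp
      finally have "1 + 2 * C * real (q \<epsilon>) ^ N / \<epsilon> \<le> (1 + 2 * C * A ^ N) * \<epsilon> powr (- (p * real N + 1))"
        by (simp add: algebra_simps)
      moreover have "0 < 1 + 2 * C * real (q \<epsilon>) ^ N / \<epsilon>" using C \<epsilon> by (intro add_pos_nonneg) auto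
      moreover have A1: "0 < 1 + 2 * C * A ^ N" using C A by (intro add_pos_nonneg) auto
      ultimately have "l \<epsilon> \<le> ln ((1 + 2 * C * A ^ N) * \<epsilon> powr (- (p * real N + 1)))"
        unfolding l_def by (subst ln_le_cancel_iff) (use \<epsilon> in auto)
      also have "\<dots> = ln (1 + 2 * C * A ^ N) + (p * real N + 1) * ln (1 / \<epsilon>)"
        using A1 \<epsilon> by (subst ln_mult) (simp_all add: ln_powr ln_div left_diff_distrib distrib_right)
      also have "\<dots> \<le> ln (1 + 2 * C * A ^ N) * ln (1 / \<epsilon>) + (p * real N + 1) * ln (1 / \<epsilon>)"
        using ln1 C A mult_left_mono[OF ln1, of "ln (1 + 2 * C * A ^ N)"] by simp
      finally have lB: "l \<epsilon> \<le> B * ln (1 / \<epsilon>)" by (simp add: B_def algebra_simps)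
      have "0 \<le> (real (q \<epsilon>))\<^sup>2 / r * l \<epsilon>" using l(1)[OF \<epsilon>(1)] r by simp
      then have "real (T \<epsilon>) \<le> (real (q \<epsilon>))\<^sup>2 / r * l \<epsilon> + 1" unfolding T_def by linarith
      also have "\<dots> \<le> (A * \<epsilon> powr (- p))\<^sup>2 / r * (B * ln (1 / \<epsilon>)) + \<epsilon> powr (- (2 * p)) * ln (1 / \<epsilon>)"
      proof (intro add_mono mult_mono divide_right_mono power_mono)
        show "1 \<le> \<epsilon> powr (- (2 * p)) * ln (1 / \<epsilon>)"
          using mult_mono[OF e1[of "2 * p"] ln1] p by simp
      qed (use q lB r l(1)[OF \<epsilon>(1)] in auto)
      also have "(A * \<epsilon> powr (- p))\<^sup>2 = A\<^sup>2 * \<epsilon> powr (- (2 * p))"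
        using \<epsilon> by (simp add: power_mult_distrib powr_power mult.commute)
      finally show ?thesis by (simp add: algebra_simps)
    qed
    moreover have "0 \<le> ln (1 / \<epsilon>)" if "0 < \<epsilon>" "\<epsilon> < exp (- 1)" for \<epsilon> :: real
    proof -
      have "\<epsilon> \<le> 1" using that exp_le_one_iff[of "-1"] by linarith
      then show ?thesis using that by simp
    qed
    ultimately show "\<forall>\<^sub>F \<epsilon> in at_right 0. norm (real (T \<epsilon>))
        \<le> (A\<^sup>2 / r * B + 1) * norm (\<epsilon> powr (- (2 * p)) * ln (1 / \<epsilon>))"
      by (intro eventually_mono[OF eventually_at_right_real[OF exp_gt_zero[of "-1"]]])
         (simp add: abs_mult)
  qed
  ultimately show ?thesis
    unfolding exponents m_def[symmetric] using small by (intro exI[of _ q] exI[of _ T]) (auto simp: q_def)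
qed

text \<open>The finitely many exceptional values go into the constant, because
  \<open>real q ^ k\<close> is at least 1 for positive \<open>q\<close>.\<close>

lemma polynomial_bound:
  fixes f :: "nat \<Rightarrow> real"
  assumes "f \<in> O(\<lambda>q. real q ^ k)"
  shows "\<exists>c\<ge>0. \<forall>q>0. \<bar>f q\<bar> \<le> c * real q ^ k"
proof -
  from assms obtain c where c: "c > 0" and ev: "\<forall>\<^sub>F q in sequentially. norm (f q) \<le> c * norm (real q ^ k)"
    by (elim landau_o.bigE)
  then obtain Q where Q: "\<And>q. q \<ge> Q \<Longrightarrow> \<bar>f q\<bar> \<le> c * real q ^ k"
    by (auto simp: eventually_sequentially)
  let ?c = "c + (\<Sum>q<Q. \<bar>f q\<bar>)"
  have s: "0 \<le> (\<Sum>q<Q. \<bar>f q\<bar>)" by (intro sum_nonneg) auto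
  have "\<bar>f q\<bar> \<le> ?c * real q ^ k" if q: "q > 0" for q
  proof (cases "q \<ge> Q")
    case True
    have "c * real q ^ k \<le> ?c * real q ^ k" using s by (intro mult_right_mono) auto
    with Q[OF True] show ?thesis by simp
  next
    case False
    then have "\<bar>f q\<bar> \<le> (\<Sum>q<Q. \<bar>f q\<bar>)" by (intro member_le_sum) auto
    also have "\<dots> \<le> ?c * 1" using c by simp
    also have "\<dots> \<le> ?c * real q ^ k" using q c s by (intro mult_left_mono one_le_power) auto
    finally show ?thesis .
  qed
  then show ?thesis using c s by (intro exI[of _ ?c]) auto
qed

lemma vector_legendre_approximation:
  fixes \<theta>s :: "real \<Rightarrow> real ^ 'd::finite"
  assumes \<theta>s: "\<And>i. derivatives_bv \<nu> V (\<lambda>l. \<theta>s l $ i)" and \<nu>: "2 \<le> \<nu>"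
  shows "\<exists>K b. 0 \<le> K \<and> (\<forall>c. \<bar>b c\<bar> \<le> K) \<and> (\<forall>q>0.
    (\<forall>l\<in>{-1..1}. norm (Phi_mult q l b - \<theta>s l) \<le> K / real q ^ (\<nu> - 1)) \<and>
    continuous_on {-1..1} (\<lambda>l. (norm (Phi_mult q l b - \<theta>s l))\<^sup>2) \<and>
    integral {-1..1} (\<lambda>l. (norm (Phi_mult q l b - \<theta>s l))\<^sup>2) / 2 \<le> K\<^sup>2 / real q ^ (2 * \<nu>))"
proof -
  define approx where "approx i K a \<longleftrightarrow> 0 \<le> K \<and> (\<forall>n. \<bar>a n\<bar> \<le> K) \<and>
    (\<forall>q>0. (\<forall>x\<in>{-1..1}. \<bar>\<theta>s x $ i - (\<Sum>n<q. a n * legendre n x)\<bar> \<le> K / real q ^ (\<nu> - 1)) \<and>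
      integral {-1..1} (\<lambda>x. (\<theta>s x $ i - (\<Sum>n<q. a n * legendre n x))\<^sup>2) \<le> 2 * K\<^sup>2 / real q ^ (2 * \<nu>))"
    for i and K :: real and a
  have "\<forall>i. \<exists>K a. approx i K a"
    unfolding approx_def using legendre_approximation[OF \<theta>s \<nu>] by blast
  then obtain K a where "\<And>i. approx i (K i) (a i)" by metis
  then have K: "\<And>i. 0 \<le> K i" "\<And>i n. \<bar>a i n\<bar> \<le> K i"
    and sup: "\<And>i q x. \<lbrakk>0 < q; x \<in> {-1..1}\<rbrakk> \<Longrightarrow>
      \<bar>\<theta>s x $ i - (\<Sum>n<q. a i n * legendre n x)\<bar> \<le> K i / real q ^ (\<nu> - 1)"
    and int: "\<And>i q. 0 < q \<Longrightarrow> integral {-1..1} (\<lambda>x. (\<theta>s x $ i - (\<Sum>n<q. a i n * legendre n x))\<^sup>2)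
      \<le> 2 * (K i)\<^sup>2 / real q ^ (2 * \<nu>)"
    unfolding approx_def by blast+
  \<comment> \<open>A sum dominates the l1 bound on the norm, and its square dominates the sum of
    the squares, so one constant serves both errors.\<close>
  define S where "S = (\<Sum>i\<in>UNIV. K i)"
  have S: "K i \<le> S" for i unfolding S_def using K(1) by (intro member_le_sum) auto
  have S0: "0 \<le> S" unfolding S_def using K(1) by (intro sum_nonneg) auto
  define b where "b = (\<lambda>(i, n). a i n)"
  have nth: "(Phi_mult q l b - \<theta>s l) $ i = - (\<theta>s l $ i - (\<Sum>n<q. a i n * legendre n l))" for q l i
    by (simp add: Phi_mult_nth b_def mult.commute)
  have sq: "(norm (Phi_mult q l b - \<theta>s l))\<^sup>2 = (\<Sum>i\<in>UNIV. (\<theta>s l $ i - (\<Sum>n<q. a i n * legendre n l))\<^sup>2)" for q l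
    unfolding norm_vec_square nth power2_minus ..
  have cont: "continuous_on {-1..1} (\<lambda>l. (\<theta>s l $ i - (\<Sum>n<q. a i n * legendre n l))\<^sup>2)" for q i
    using derivatives_bv_continuous_on[OF \<theta>s[of i]] \<nu>
    by (intro continuous_on_power continuous_on_diff continuous_on_sum continuous_on_mult
          continuous_on_const continuous_on_legendre continuous_on_id) auto
  show ?thesis
  proof (intro exI[of _ S] exI[of _ b] conjI allI impI ballI S0)
    show "\<bar>b c\<bar> \<le> S" for c
      using K(2)[of "fst c" "snd c"] S[of "fst c"] by (auto simp: b_def split: prod.splits)
    fix q :: nat assume q: "0 < q"
    show "norm (Phi_mult q l b - \<theta>s l) \<le> S / real q ^ (\<nu> - 1)" if l: "l \<in> {-1..1}" for l
    proof -
      have "norm (Phi_mult q l b - \<theta>s l) \<le> (\<Sum>i\<in>UNIV. \<bar>(Phi_mult q l b - \<theta>s l) $ i\<bar>)"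
        by (rule norm_le_l1_cart)
      also have "\<dots> \<le> (\<Sum>i\<in>UNIV. K i / real q ^ (\<nu> - 1))"
        using sup[OF q l] unfolding nth abs_minus_cancel by (intro sum_mono)
      finally show ?thesis by (simp add: S_def sum_divide_distrib)
    qed
    show "continuous_on {-1..1} (\<lambda>l. (norm (Phi_mult q l b - \<theta>s l))\<^sup>2)"
      unfolding sq by (intro continuous_intros cont)
    have "integral {-1..1} (\<lambda>l. (norm (Phi_mult q l b - \<theta>s l))\<^sup>2)
        = (\<Sum>i\<in>UNIV. integral {-1..1} (\<lambda>l. (\<theta>s l $ i - (\<Sum>n<q. a i n * legendre n l))\<^sup>2))"
      unfolding sq by (intro Henstock_Kurzweil_Integration.integral_sum integrable_continuous_real cont) auto
    also have "\<dots> \<le> (\<Sum>i\<in>UNIV. 2 * (K i)\<^sup>2 / real q ^ (2 * \<nu>))"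
      by (intro sum_mono int q)
    also have "\<dots> = 2 * (\<Sum>i\<in>UNIV. K i * K i) / real q ^ (2 * \<nu>)"
      by (simp add: sum_divide_distrib sum_distrib_left power2_eq_square)
    also have "(\<Sum>i\<in>UNIV. K i * K i) \<le> (\<Sum>i\<in>UNIV. K i * S)"
      using K(1) S by (intro sum_mono mult_left_mono)
    also have "\<dots> = S\<^sup>2" by (simp add: S_def sum_distrib_right power2_eq_square)
    finally show "integral {-1..1} (\<lambda>l. (norm (Phi_mult q l b - \<theta>s l))\<^sup>2) / 2 \<le> S\<^sup>2 / real q ^ (2 * \<nu>)"
      using q by (simp add: divide_right_mono mult.commute)
  qed
qed

text \<open>The initial point may vary with \<open>q\<close>, as its dimension does; any fixed
  finitely supported array is covered. Its growth exponent \<open>k\<close> affects only the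
  constant in the bound for \<open>T\<close>.\<close>

theorem theorem4p3:
  fixes h :: "real ^ 'd \<Rightarrow> real \<Rightarrow> real"
    and \<theta>s :: "real \<Rightarrow> real ^ 'd"
    and \<mu> L V \<eta>bar :: real
    and \<nu> k :: nat
    and \<beta>\<^sub>0 :: "nat \<Rightarrow> 'd \<times> nat \<Rightarrow> real"
    and M :: "'w measure"
    and X :: "nat \<Rightarrow> 'w \<Rightarrow> real"
  assumes "0 < \<mu>" and "\<mu> \<le> L"
    and "\<And>l. l \<in> {-1..1} \<Longrightarrow> strongly_convex_smooth \<mu> L (\<lambda>\<theta>. h \<theta> l)"
    and "\<And>\<theta>. h \<theta> \<in> borel_measurable (restrict_space borel {-1..1})"
    and "\<And>l. l \<in> {-1..1} \<Longrightarrow> is_arg_min (\<lambda>\<theta>. h \<theta> l) (\<lambda>_. True) (\<theta>s l)"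
    and "2 \<le> \<nu>" and "0 < V"
    and "\<And>i. derivatives_bv \<nu> V (\<lambda>l. \<theta>s l $ i)"
    and "0 < \<eta>bar" and "\<eta>bar \<le> 1"
    and "(\<lambda>q. L2_set (\<beta>\<^sub>0 q) (coeff_index q)) \<in> O(\<lambda>q. real q ^ k)"
    and "prob_space M"
    and "\<And>t w. w \<in> space M \<Longrightarrow> X t w \<in> {-1..1}"
    and "prob_space.indep_vars M (\<lambda>_. borel) X UNIV"
    and "\<And>t. distr M borel (X t) = uniform_measure lborel {-1..1}"
  shows "\<exists>(q :: real \<Rightarrow> nat) (T :: real \<Rightarrow> nat).
     (\<lambda>\<epsilon>. real (q \<epsilon>)) \<in> O[at_right 0](\<lambda>\<epsilon>. \<epsilon> powr (1 / (2 * (1 - real \<nu>)))) \<and>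
     (\<lambda>\<epsilon>. real (T \<epsilon>)) \<in> O[at_right 0](\<lambda>\<epsilon>. \<epsilon> powr (1 / (1 - real \<nu>)) * ln (1 / \<epsilon>)) \<and>
     (\<forall>\<epsilon>>0. 1 \<le> q \<epsilon> \<and>
        (let err = (\<lambda>w. solution_path_error h \<theta>s (q \<epsilon>)
                     (sgd h (q \<epsilon>) (\<eta>bar / (C_p TYPE('d) (q \<epsilon>) * L)) (\<beta>\<^sub>0 (q \<epsilon>))
                          (\<lambda>t. X t w) (T \<epsilon>)))
         in integrable M err \<and> prob_space.expectation M err \<le> \<epsilon>))"
proof -
  interpret solution_path h \<theta>s \<mu> L
    by unfold_locales (use assms in auto)
  interpret uniform_samples M X
    using assms(12-15) by (intro uniform_samples.intro uniform_samples_axioms.intro)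
  obtain K b where K: "0 \<le> K" and b: "\<And>c. \<bar>b c\<bar> \<le> K"
    and "\<forall>q>0. (\<forall>l\<in>{-1..1}. norm (Phi_mult q l b - \<theta>s l) \<le> K / real q ^ (\<nu> - 1)) \<and>
      continuous_on {-1..1} (\<lambda>l. (norm (Phi_mult q l b - \<theta>s l))\<^sup>2) \<and>
      integral {-1..1} (\<lambda>l. (norm (Phi_mult q l b - \<theta>s l))\<^sup>2) / 2 \<le> K\<^sup>2 / real q ^ (2 * \<nu>)"
    using vector_legendre_approximation[OF assms(8,6)] by blast
  then have sup: "\<And>q l. \<lbrakk>0 < q; l \<in> {-1..1}\<rbrakk> \<Longrightarrow> norm (Phi_mult q l b - \<theta>s l) \<le> K / real q ^ (\<nu> - 1)"
    and cont: "\<And>q. 0 < q \<Longrightarrow> continuous_on {-1..1} (\<lambda>l. (norm (Phi_mult q l b - \<theta>s l))\<^sup>2)"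
    and res: "\<And>q. 0 < q \<Longrightarrow>
      integral {-1..1} (\<lambda>l. (norm (Phi_mult q l b - \<theta>s l))\<^sup>2) / 2 \<le> K\<^sup>2 / real q ^ (2 * \<nu>)"
    by blast+
  obtain c where c: "0 \<le> c" "\<And>q. 0 < q \<Longrightarrow> \<bar>L2_set (\<beta>\<^sub>0 q) (coeff_index q)\<bar> \<le> c * real q ^ k"
    using polynomial_bound[OF assms(11)] by blast
  \<comment> \<open>From \<open>(x - y)\<^sup>2 \<le> 2 * x\<^sup>2 + 2 * y\<^sup>2\<close>, summed
    over the d q coefficients.\<close>
  define D where "D = 2 * c\<^sup>2 + 2 * real CARD('d) * K\<^sup>2"
  \<comment> \<open>The summands stem from the initial distance, the noise floor and the uniform
    error; the last one ensures positivity.\<close>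
  define C where "C = L * D + 2 * L\<^sup>2 * K\<^sup>2 / \<mu> + L * K\<^sup>2 + 1"
  define r where "r = \<eta>bar * \<mu> / (2 * L)"
  have D: "D \<ge> 0" by (simp add: D_def)
  have C1: "0 < C" "L * D \<le> C" "2 * L\<^sup>2 * K\<^sup>2 / \<mu> + L * K\<^sup>2 \<le> C"
    using L_pos \<mu>_pos D by (simp_all add: C_def add_nonneg_pos)
  have r: "0 < r" using assms L_pos by (simp add: r_def)
  \<comment> \<open>The exponent \<open>2 * k + 1\<close> dominates both \<open>2 * k\<close>, from
    the initial point, and 1, from the number of entries of \<open>b\<close>.\<close>
  have init: "(\<Sum>c\<in>coeff_index q. (\<beta>\<^sub>0 q c - b c)\<^sup>2) \<le> D * real q ^ (2 * k + 1)" if q: "0 < q" for q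
  proof -
    have "(\<Sum>c\<in>coeff_index q. (\<beta>\<^sub>0 q c - b c)\<^sup>2) \<le> (\<Sum>c\<in>coeff_index q. 2 * (\<beta>\<^sub>0 q c)\<^sup>2 + 2 * K\<^sup>2)"
    proof (rule sum_mono)
      fix c
      have "0 \<le> (\<beta>\<^sub>0 q c + b c)\<^sup>2" by simp
      then have "(\<beta>\<^sub>0 q c - b c)\<^sup>2 \<le> 2 * (\<beta>\<^sub>0 q c)\<^sup>2 + 2 * \<bar>b c\<bar>\<^sup>2"
        by (simp add: power2_eq_square algebra_simps)
      moreover have "\<bar>b c\<bar>\<^sup>2 \<le> K\<^sup>2" using b by (intro power_mono) auto
      ultimately show "(\<beta>\<^sub>0 q c - b c)\<^sup>2 \<le> 2 * (\<beta>\<^sub>0 q c)\<^sup>2 + 2 * K\<^sup>2" by linarith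
    qed
    also have "\<dots> = 2 * (L2_set (\<beta>\<^sub>0 q) (coeff_index q))\<^sup>2 + real CARD('d) * real q * (2 * K\<^sup>2)"
      by (simp add: sum.distrib sum_distrib_left L2_set_def sum_nonneg coeff_index_def card_cartesian_product)
    also have "(L2_set (\<beta>\<^sub>0 q) (coeff_index q))\<^sup>2 \<le> (c * real q ^ k)\<^sup>2"
      using c(2)[OF q] by (metis abs_ge_zero power2_abs power_mono)
    also have "\<dots> = c\<^sup>2 * real q ^ (2 * k)" by (simp add: power_mult_distrib power_mult[symmetric] mult.commute)
    also have "\<dots> \<le> c\<^sup>2 * real q ^ (2 * k + 1)"
      using q by (intro mult_left_mono power_increasing) auto
    also have "real CARD('d) * real q * (2 * K\<^sup>2) = 2 * real CARD('d) * K\<^sup>2 * real q ^ 1" by simp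
    also have "\<dots> \<le> 2 * real CARD('d) * K\<^sup>2 * real q ^ (2 * k + 1)"
      using q by (intro mult_left_mono power_increasing) auto
    finally show ?thesis by (simp add: D_def algebra_simps)
  qed
  let ?err = "\<lambda>q T w. solution_path_error h \<theta>s q
      (sgd h q (\<eta>bar / (C_p TYPE('d) q * L)) (\<beta>\<^sub>0 q) (\<lambda>t. X t w) T)"
  have main: "integrable M (?err q T) \<and> expectation (?err q T)
      \<le> C / real q ^ (2 * (\<nu> - 1)) + C * real q ^ (2 * k + 2) * exp (- r * real T / (real q)\<^sup>2)"
    if q: "0 < q" for q T
  proof -
    define Q where "Q = real q"
    have Q: "Q > 0" using q by (simp add: Q_def)
    define \<eta> where "\<eta> = \<eta>bar / (C_p TYPE('d) q * L)"
    have \<eta>: "\<eta> = \<eta>bar / (Q * L)" by (simp add: \<eta>_def C_p_eq[OF q] Q_def)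
    interpret sgd_run h \<theta>s \<mu> L M X q \<eta> "\<beta>\<^sub>0 q" b "K / real q ^ (\<nu> - 1)"
      using q sup cont assms(9,10) Q L_pos by unfold_locales (auto simp: \<eta> Q_def)
    define \<rho> where "\<rho> = \<eta> * \<mu> / real (2 * q)"
    have \<rho>: "\<rho> = r / Q\<^sup>2"
      by (simp add: \<rho>_def \<eta> r_def power2_eq_square flip: Q_def)
    have "1 - \<rho> \<le> exp (- \<rho>)" using exp_ge_add_one_self[of "- \<rho>"] by simp
    then have "(1 - \<rho>) ^ T \<le> exp (- \<rho>) ^ T"
      using contraction_le_1 by (intro power_mono) (auto simp: \<rho>_def)
    also have "\<dots> = exp (- r * real T / Q\<^sup>2)"
      by (simp add: \<rho> exp_of_nat_mult[symmetric] mult.commute)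
    finally have decay: "(1 - \<rho>) ^ T \<le> exp (- r * real T / Q\<^sup>2)" .
    let ?E = "exp (- r * real T / Q\<^sup>2)"
    have "\<nu> = Suc (\<nu> - 1)" using assms(6) by simp
    \<comment> \<open>The split-off \<open>Q\<^sup>2\<close> cancels the two factors
      \<open>Q\<close> in front of the residual, one from the noise floor and one from the
      supremum.\<close>
    then have pow: "Q ^ (2 * \<nu>) = Q\<^sup>2 * Q ^ (2 * (\<nu> - 1))"
      by (metis mult_Suc_right power_add)
    have "expectation (?err q T) \<le> L * (Q * ((1 - \<rho>) ^ T * (\<Sum>c\<in>coeff_index q. (\<beta>\<^sub>0 q c - b c)\<^sup>2)
          + 2 * Q * L * residual / \<mu>) + (K / Q ^ (\<nu> - 1))\<^sup>2)"
      using expected_error(2)[of T] unfolding iterate_def \<rho>_def[symmetric]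
      unfolding \<eta>_def Q_def .
    also have "\<dots> \<le> L * (Q * (?E * (D * Q ^ (2 * k + 1)) + 2 * Q * L * (K\<^sup>2 / Q ^ (2 * \<nu>)) / \<mu>)
          + (K / Q ^ (\<nu> - 1))\<^sup>2)"
      using init[OF q] res[OF q] decay L_pos \<mu>_pos Q
      by (intro mult_left_mono add_mono mult_mono divide_right_mono)
         (auto simp: Q_def residual_def intro!: sum_nonneg residual_nonneg)
    also have "\<dots> = L * D * Q ^ (2 * k + 2) * ?E + (2 * L\<^sup>2 * K\<^sup>2 / \<mu> + L * K\<^sup>2) / Q ^ (2 * (\<nu> - 1))"
      using Q \<mu>_pos unfolding pow
      by (simp add: field_simps power2_eq_square power_mult power_divide)
    also have "\<dots> \<le> C * Q ^ (2 * k + 2) * ?E + C / Q ^ (2 * (\<nu> - 1))"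
      using C1 Q by (intro add_mono mult_right_mono divide_right_mono) auto
    finally show ?thesis
      using expected_error(1)[of T] unfolding iterate_def unfolding \<eta>_def Q_def by simp
  qed
  obtain q T where "(\<lambda>\<epsilon>. real (q \<epsilon>)) \<in> O[at_right 0](\<lambda>\<epsilon>. \<epsilon> powr (1 / (2 * (1 - real \<nu>))))"
    "(\<lambda>\<epsilon>. real (T \<epsilon>)) \<in> O[at_right 0](\<lambda>\<epsilon>. \<epsilon> powr (1 / (1 - real \<nu>)) * ln (1 / \<epsilon>))"
    and qT: "\<And>\<epsilon>. 0 < \<epsilon> \<Longrightarrow> 1 \<le> q \<epsilon> \<and> C / real (q \<epsilon>) ^ (2 * (\<nu> - 1))
        + C * real (q \<epsilon>) ^ (2 * k + 2) * exp (- r * real (T \<epsilon>) / (real (q \<epsilon>))\<^sup>2) \<le> \<epsilon>"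
    using sgd_parameter_choice[OF C1(1) r assms(6), of "2 * k + 2"] by auto
  moreover have "1 \<le> q \<epsilon> \<and> integrable M (?err (q \<epsilon>) (T \<epsilon>)) \<and> expectation (?err (q \<epsilon>) (T \<epsilon>)) \<le> \<epsilon>"
    if "0 < \<epsilon>" for \<epsilon>
    using qT[OF that] main[of "q \<epsilon>" "T \<epsilon>"] by (auto intro: order_trans)
  ultimately show ?thesis
    unfolding Let_def by blast
qed

end
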